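(* Let $C$ be an arbitrary coalgebra over a field $k$. The contravariant functors $F,G:\mathcal{M}^C\to \mathrm{mod}\text{-}C^*$ given by $F(M)=\mathrm{Hom}_k(M,k)$ and $G(M)=\mathrm{Hom}_{C^*}({}_{C^*}M,{}_{C^*}C)$ are naturally equivalent (i.e. naturally isomorphic).
   Context: For a coalgebra $C$ over $k$ with $\Delta(x)=\sum x_1\otimes x_2$, the dual $C^*$ is an algebra with the convolution product $(c^*d^* )(x)=\sum c^*(x_1)d^*(x_2)$. $C$ is a $(C^*,C^* )$-bimodule with $c^*\cdot x=\sum c^*(x_2)x_1$ and $x\cdot c^*=\sum c^*(x_1)x_2$. $\mathcal{M}^C$ is the category of right $C$-comodules; a right $C$-comodule $M$ with coaction $m\mapsto\sum m_0\otimes m_1$ is a left $C^*$-module by $c^*\cdot m=\sum c^*(m_1)m_0$. $\mathrm{mod}\text{-}C^*$ is the category of right $C^*$-modules. The right $C^*$-module structures are: on $F(M)$, $(g\leftarrow c^* )(m)=g(c^*\cdot m)$; on $G(M)$ (left $C^*$-linear maps $M\to C$), $(f\leftarrow c^* )(m)=f(m)\cdot c^*$. On morphisms both functors act by precomposition. *)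

theory Defs
  imports "HOL-Algebra.Module" "HOL-Algebra.Free_Abelian_Groups"
begin

text \<open>All structures are records with explicit carriers in the style of HOL-Algebra, and maps
  between them are extensional functions (\<open>\<rightarrow>\<^sub>E\<close>), so that two maps are equal iff they agree on
  their domain. The fields \<open>mult\<close> and \<open>one\<close> that module records inherit from
  \<^type>\<open>ring\<close> are irrelevant.\<close>

definition lin_maps ::
  "('k, 'z) ring_scheme \<Rightarrow> ('k, 'm, 'u) module_scheme \<Rightarrow> ('k, 'n, 'v) module_scheme \<Rightarrow> ('m \<Rightarrow> 'n) set"
  where "lin_maps K M N =
    {f \<in> carrier M \<rightarrow>\<^sub>E carrier N.
       (\<forall>x\<in>carrier M. \<forall>y\<in>carrier M. f (x \<oplus>\<^bsub>M\<^esub> y) = f x \<oplus>\<^bsub>N\<^esub> f y) \<and>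
       (\<forall>a\<in>carrier K. \<forall>x\<in>carrier M. f (a \<odot>\<^bsub>M\<^esub> x) = a \<odot>\<^bsub>N\<^esub> f x)}"

definition base_module :: "('k, 'z) ring_scheme \<Rightarrow> ('k, 'k) module"
  where "base_module K = \<lparr>carrier = carrier K, mult = mult K, one = one K,
    ring.zero = ring.zero K, add = add K, smult = mult K\<rparr>"

text \<open>\<open>M \<otimes>\<^sub>K N\<close> is the quotient of the free abelian group on \<open>M \<times> N\<close> by the
  subgroup generated by the usual relations.\<close>

type_synonym ('m, 'n) tens = "('m \<times> 'n \<Rightarrow>\<^sub>0 int) set"

definition tensor_free ::
  "('k, 'm, 'u) module_scheme \<Rightarrow> ('k, 'n, 'v) module_scheme \<Rightarrow> ('m \<times> 'n \<Rightarrow>\<^sub>0 int) monoid"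
  where "tensor_free M N = free_Abelian_group (carrier M \<times> carrier N)"

definition tensor_relations ::
  "('k, 'z) ring_scheme \<Rightarrow> ('k, 'm, 'u) module_scheme \<Rightarrow> ('k, 'n, 'v) module_scheme
    \<Rightarrow> ('m \<times> 'n \<Rightarrow>\<^sub>0 int) set"
  where "tensor_relations K M N =
    {frag_of (x \<oplus>\<^bsub>M\<^esub> x', y) - frag_of (x, y) - frag_of (x', y) |x x' y.
       x \<in> carrier M \<and> x' \<in> carrier M \<and> y \<in> carrier N} \<union>
    {frag_of (x, y \<oplus>\<^bsub>N\<^esub> y') - frag_of (x, y) - frag_of (x, y') |x y y'.
       x \<in> carrier M \<and> y \<in> carrier N \<and> y' \<in> carrier N} \<union>
    {frag_of (a \<odot>\<^bsub>M\<^esub> x, y) - frag_of (x, a \<odot>\<^bsub>N\<^esub> y) |a x y.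
       a \<in> carrier K \<and> x \<in> carrier M \<and> y \<in> carrier N}"

definition tensor_null ::
  "('k, 'z) ring_scheme \<Rightarrow> ('k, 'm, 'u) module_scheme \<Rightarrow> ('k, 'n, 'v) module_scheme
    \<Rightarrow> ('m \<times> 'n \<Rightarrow>\<^sub>0 int) set"
  where "tensor_null K M N = generate (tensor_free M N) (tensor_relations K M N)"

text \<open>Scalar multiplication is \<open>a (x \<otimes> y) = (a x) \<otimes> y\<close>, extended additively; the union
  below is over representatives of one coset, all of which give the same coset.\<close>

definition tensor ::
  "('k, 'z) ring_scheme \<Rightarrow> ('k, 'm, 'u) module_scheme \<Rightarrow> ('k, 'n, 'v) module_scheme
    \<Rightarrow> ('k, ('m, 'n) tens) module"
  where "tensor K M N =
    (let Q = tensor_free M N Mod tensor_null K M N in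
     \<lparr>carrier = carrier Q, mult = undefined, one = undefined,
      ring.zero = one Q, add = mult Q,
      smult = (\<lambda>a t. \<Union>u\<in>t. tensor_null K M N #>\<^bsub>tensor_free M N\<^esub>
                        frag_extend (\<lambda>(x, y). frag_of (a \<odot>\<^bsub>M\<^esub> x, y)) u)\<rparr>)"

definition pure_tensor ::
  "('k, 'z) ring_scheme \<Rightarrow> ('k, 'm, 'u) module_scheme \<Rightarrow> ('k, 'n, 'v) module_scheme
    \<Rightarrow> 'm \<Rightarrow> 'n \<Rightarrow> ('m, 'n) tens"
  where "pure_tensor K M N x y = tensor_null K M N #>\<^bsub>tensor_free M N\<^esub> frag_of (x, y)"

text \<open>For bilinear \<open>b : M \<times> N \<rightarrow> P\<close>, the linear map \<open>M \<otimes> N \<rightarrow> P\<close> with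
  \<open>x \<otimes> y \<mapsto> b x y\<close>. In Sweedler notation, \<open>tensor_lift K M N P b t\<close> is
  \<open>\<Sum> b t\<^sub>1 t\<^sub>2\<close> for \<open>t = \<Sum> t\<^sub>1 \<otimes> t\<^sub>2\<close>.\<close>

definition tensor_lift ::
  "('k, 'z) ring_scheme \<Rightarrow> ('k, 'm, 'u) module_scheme \<Rightarrow> ('k, 'n, 'v) module_scheme
    \<Rightarrow> ('k, 'p, 'w) module_scheme \<Rightarrow> ('m \<Rightarrow> 'n \<Rightarrow> 'p) \<Rightarrow> ('m, 'n) tens \<Rightarrow> 'p"
  where "tensor_lift K M N P b =
    (THE h. h \<in> lin_maps K (tensor K M N) P \<and>
       (\<forall>x\<in>carrier M. \<forall>y\<in>carrier N. h (pure_tensor K M N x y) = b x y))"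

definition tensor_map ::
  "('k, 'z) ring_scheme \<Rightarrow> ('k, 'm, 'u) module_scheme \<Rightarrow> ('k, 'n, 'v) module_scheme
    \<Rightarrow> ('k, 'p, 'w) module_scheme \<Rightarrow> ('k, 'q, 'y) module_scheme
    \<Rightarrow> ('m \<Rightarrow> 'p) \<Rightarrow> ('n \<Rightarrow> 'q) \<Rightarrow> ('m, 'n) tens \<Rightarrow> ('p, 'q) tens"
  where "tensor_map K M N P Q f g =
    tensor_lift K M N (tensor K P Q) (\<lambda>x y. pure_tensor K P Q (f x) (g y))"

definition tensor_assoc ::
  "('k, 'z) ring_scheme \<Rightarrow> ('k, 'm, 'u) module_scheme \<Rightarrow> ('k, 'n, 'v) module_scheme
    \<Rightarrow> ('k, 'p, 'w) module_scheme \<Rightarrow> (('m, 'n) tens, 'p) tens \<Rightarrow> ('m, ('n, 'p) tens) tens"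
  where "tensor_assoc K M N P =
    (let T = tensor K M (tensor K N P) in
     tensor_lift K (tensor K M N) P T
       (\<lambda>t z. tensor_lift K M N T
          (\<lambda>x y. pure_tensor K M (tensor K N P) x (pure_tensor K N P y z)) t))"

record ('k, 'c) coalgebra = "('k, 'c) module" +
  comult :: "'c \<Rightarrow> ('c, 'c) tens"
  counit :: "'c \<Rightarrow> 'k"

locale coalgebra =
  fixes K :: "('k, 'z) ring_scheme" and C :: "('k, 'c) coalgebra"
  assumes base_field: "field K"
    and vector_space: "module K C"
    and comult_linear: "comult C \<in> lin_maps K C (tensor K C C)"
    and counit_linear: "counit C \<in> lin_maps K C (base_module K)"
    and coassoc: "\<And>x. x \<in> carrier C \<Longrightarrow>
      tensor_assoc K C C C
        (tensor_map K C C (tensor K C C) C (comult C) (\<lambda>c\<in>carrier C. c) (comult C x)) =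
      tensor_map K C C C (tensor K C C) (\<lambda>c\<in>carrier C. c) (comult C) (comult C x)"
    and counit_left: "\<And>x. x \<in> carrier C \<Longrightarrow>
      tensor_lift K C C C (\<lambda>x1 x2. counit C x1 \<odot>\<^bsub>C\<^esub> x2) (comult C x) = x"
    and counit_right: "\<And>x. x \<in> carrier C \<Longrightarrow>
      tensor_lift K C C C (\<lambda>x1 x2. counit C x2 \<odot>\<^bsub>C\<^esub> x1) (comult C x) = x"

record ('k, 'm, 'c) comodule = "('k, 'm) module" +
  coact :: "'m \<Rightarrow> ('m, 'c) tens"

locale comodule =
  fixes K :: "('k, 'z) ring_scheme" and C :: "('k, 'c) coalgebra"
    and M :: "('k, 'm, 'c) comodule"
  assumes coalgebra: "coalgebra K C"
    and vector_space: "module K M"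
    and coact_linear: "coact M \<in> lin_maps K M (tensor K M C)"
    and coact_coassoc: "\<And>m. m \<in> carrier M \<Longrightarrow>
      tensor_assoc K M C C
        (tensor_map K M C (tensor K M C) C (coact M) (\<lambda>c\<in>carrier C. c) (coact M m)) =
      tensor_map K M C M (tensor K C C) (\<lambda>x\<in>carrier M. x) (comult C) (coact M m)"
    and coact_counit: "\<And>m. m \<in> carrier M \<Longrightarrow>
      tensor_lift K M C M (\<lambda>m0 m1. counit C m1 \<odot>\<^bsub>M\<^esub> m0) (coact M m) = m"

definition comodule_maps ::
  "('k, 'z) ring_scheme \<Rightarrow> ('k, 'c) coalgebra \<Rightarrow> ('k, 'm, 'c) comodule
    \<Rightarrow> ('k, 'n, 'c) comodule \<Rightarrow> ('m \<Rightarrow> 'n) set"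
  where "comodule_maps K C M N =
    {f \<in> lin_maps K M N. \<forall>m\<in>carrier M.
       coact N (f m) = tensor_map K M C N C f (\<lambda>c\<in>carrier C. c) (coact M m)}"

definition regular_comodule :: "('k, 'c) coalgebra \<Rightarrow> ('k, 'c, 'c) comodule"
  where "regular_comodule C = \<lparr>carrier = carrier C, mult = mult C, one = one C,
    ring.zero = ring.zero C, add = add C, smult = smult C, coact = comult C\<rparr>"

definition dual_algebra :: "('k, 'z) ring_scheme \<Rightarrow> ('k, 'c) coalgebra \<Rightarrow> ('c \<Rightarrow> 'k) ring"
  where "dual_algebra K C =
    \<lparr>carrier = lin_maps K C (base_module K),
     mult = (\<lambda>c d. \<lambda>x\<in>carrier C.
       tensor_lift K C C (base_module K) (\<lambda>x1 x2. c x1 \<otimes>\<^bsub>K\<^esub> d x2) (comult C x)),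
     one = counit C,
     ring.zero = (\<lambda>x\<in>carrier C. \<zero>\<^bsub>K\<^esub>),
     add = (\<lambda>c d. \<lambda>x\<in>carrier C. c x \<oplus>\<^bsub>K\<^esub> d x)\<rparr>"

text \<open>\<open>c\<^sup>* \<cdot> m = \<Sum> c\<^sup>*(m\<^sub>1) m\<^sub>0\<close>; for \<^term>\<open>regular_comodule C\<close> this is
  \<open>c\<^sup>* \<cdot> x = \<Sum> c\<^sup>*(x\<^sub>2) x\<^sub>1\<close>.\<close>

definition dual_left_act ::
  "('k, 'z) ring_scheme \<Rightarrow> ('k, 'c) coalgebra \<Rightarrow> ('k, 'm, 'c) comodule \<Rightarrow> ('c \<Rightarrow> 'k) \<Rightarrow> 'm \<Rightarrow> 'm"
  where "dual_left_act K C M c m =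
    tensor_lift K M C M (\<lambda>m0 m1. c m1 \<odot>\<^bsub>M\<^esub> m0) (coact M m)"

text \<open>\<open>x \<cdot> c\<^sup>* = \<Sum> c\<^sup>*(x\<^sub>1) x\<^sub>2\<close>.\<close>

definition dual_right_act ::
  "('k, 'z) ring_scheme \<Rightarrow> ('k, 'c) coalgebra \<Rightarrow> 'c \<Rightarrow> ('c \<Rightarrow> 'k) \<Rightarrow> 'c"
  where "dual_right_act K C x c =
    tensor_lift K C C C (\<lambda>x1 x2. c x1 \<odot>\<^bsub>C\<^esub> x2) (comult C x)"

definition dual_left_module ::
  "('k, 'z) ring_scheme \<Rightarrow> ('k, 'c) coalgebra \<Rightarrow> ('k, 'm, 'c) comodule \<Rightarrow> ('c \<Rightarrow> 'k, 'm) module"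
  where "dual_left_module K C M = \<lparr>carrier = carrier M, mult = mult M, one = one M,
    ring.zero = ring.zero M, add = add M, smult = dual_left_act K C M\<rparr>"

record ('r, 'b) rmodule = "'b ring" +
  ract :: "'b \<Rightarrow> 'r \<Rightarrow> 'b"

locale right_module =
  fixes R :: "('r, 'z) ring_scheme" and X :: "('r, 'b) rmodule"
  assumes ring: "ring R"
    and abelian_group: "abelian_group X"
    and ract_closed: "\<And>x r. \<lbrakk>x \<in> carrier X; r \<in> carrier R\<rbrakk> \<Longrightarrow> ract X x r \<in> carrier X"
    and ract_add_left: "\<And>x y r. \<lbrakk>x \<in> carrier X; y \<in> carrier X; r \<in> carrier R\<rbrakk> \<Longrightarrow>
      ract X (x \<oplus>\<^bsub>X\<^esub> y) r = ract X x r \<oplus>\<^bsub>X\<^esub> ract X y r"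
    and ract_add_right: "\<And>x r s. \<lbrakk>x \<in> carrier X; r \<in> carrier R; s \<in> carrier R\<rbrakk> \<Longrightarrow>
      ract X x (r \<oplus>\<^bsub>R\<^esub> s) = ract X x r \<oplus>\<^bsub>X\<^esub> ract X x s"
    and ract_mult: "\<And>x r s. \<lbrakk>x \<in> carrier X; r \<in> carrier R; s \<in> carrier R\<rbrakk> \<Longrightarrow>
      ract X x (r \<otimes>\<^bsub>R\<^esub> s) = ract X (ract X x r) s"
    and ract_one: "\<And>x. x \<in> carrier X \<Longrightarrow> ract X x \<one>\<^bsub>R\<^esub> = x"

definition rmodule_maps ::
  "('r, 'z) ring_scheme \<Rightarrow> ('r, 'a) rmodule \<Rightarrow> ('r, 'b) rmodule \<Rightarrow> ('a \<Rightarrow> 'b) set"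
  where "rmodule_maps R X Y =
    {f \<in> carrier X \<rightarrow>\<^sub>E carrier Y.
       (\<forall>x\<in>carrier X. \<forall>y\<in>carrier X. f (x \<oplus>\<^bsub>X\<^esub> y) = f x \<oplus>\<^bsub>Y\<^esub> f y) \<and>
       (\<forall>x\<in>carrier X. \<forall>r\<in>carrier R. f (ract X x r) = ract Y (f x) r)}"

definition rmodule_iso ::
  "('r, 'z) ring_scheme \<Rightarrow> ('r, 'a) rmodule \<Rightarrow> ('r, 'b) rmodule \<Rightarrow> ('a \<Rightarrow> 'b) set"
  where "rmodule_iso R X Y = {f \<in> rmodule_maps R X Y. bij_betw f (carrier X) (carrier Y)}"

text \<open>The maps linear over a possibly noncommutative ring \<open>R\<close> between left \<open>R\<close>-modules.\<close>

definition left_module_maps ::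
  "('r, 'z) ring_scheme \<Rightarrow> ('r, 'a) module \<Rightarrow> ('r, 'b) module \<Rightarrow> ('a \<Rightarrow> 'b) set"
  where "left_module_maps R X Y =
    {f \<in> carrier X \<rightarrow>\<^sub>E carrier Y.
       (\<forall>x\<in>carrier X. \<forall>y\<in>carrier X. f (x \<oplus>\<^bsub>X\<^esub> y) = f x \<oplus>\<^bsub>Y\<^esub> f y) \<and>
       (\<forall>r\<in>carrier R. \<forall>x\<in>carrier X. f (r \<odot>\<^bsub>X\<^esub> x) = r \<odot>\<^bsub>Y\<^esub> f x)}"

text \<open>\<open>Cmp \<C> A B D g f\<close> is the composite of \<open>f : A \<rightarrow> B\<close> and \<open>g : B \<rightarrow> D\<close>.\<close>

record ('o, 'a) cat =
  Ob :: "'o set"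
  Hom :: "'o \<Rightarrow> 'o \<Rightarrow> 'a set"
  Cmp :: "'o \<Rightarrow> 'o \<Rightarrow> 'o \<Rightarrow> 'a \<Rightarrow> 'a \<Rightarrow> 'a"
  Ide :: "'o \<Rightarrow> 'a"

locale category =
  fixes \<C> :: "('o, 'a) cat"
  assumes Ide_in_Hom: "\<And>A. A \<in> Ob \<C> \<Longrightarrow> Ide \<C> A \<in> Hom \<C> A A"
    and Cmp_in_Hom: "\<And>A B D f g.
      \<lbrakk>A \<in> Ob \<C>; B \<in> Ob \<C>; D \<in> Ob \<C>; f \<in> Hom \<C> A B; g \<in> Hom \<C> B D\<rbrakk> \<Longrightarrow>
      Cmp \<C> A B D g f \<in> Hom \<C> A D"
    and Cmp_Ide_right: "\<And>A B f. \<lbrakk>A \<in> Ob \<C>; B \<in> Ob \<C>; f \<in> Hom \<C> A B\<rbrakk> \<Longrightarrow>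
      Cmp \<C> A A B f (Ide \<C> A) = f"
    and Cmp_Ide_left: "\<And>A B f. \<lbrakk>A \<in> Ob \<C>; B \<in> Ob \<C>; f \<in> Hom \<C> A B\<rbrakk> \<Longrightarrow>
      Cmp \<C> A B B (Ide \<C> B) f = f"
    and Cmp_assoc: "\<And>A B D E f g h.
      \<lbrakk>A \<in> Ob \<C>; B \<in> Ob \<C>; D \<in> Ob \<C>; E \<in> Ob \<C>;
       f \<in> Hom \<C> A B; g \<in> Hom \<C> B D; h \<in> Hom \<C> D E\<rbrakk> \<Longrightarrow>
      Cmp \<C> A D E h (Cmp \<C> A B D g f) = Cmp \<C> A B E (Cmp \<C> B D E h g) f"

record ('o, 'a, 'p, 'b) functor_data =
  fobj :: "'o \<Rightarrow> 'p"
  fmap :: "'o \<Rightarrow> 'o \<Rightarrow> 'a \<Rightarrow> 'b"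

locale contravariant_functor =
  source: category \<C> + target: category \<D>
  for \<C> :: "('o, 'a) cat" and \<D> :: "('p, 'b) cat" +
  fixes F :: "('o, 'a, 'p, 'b) functor_data"
  assumes fobj_in_Ob: "\<And>A. A \<in> Ob \<C> \<Longrightarrow> fobj F A \<in> Ob \<D>"
    and fmap_in_Hom: "\<And>A B f. \<lbrakk>A \<in> Ob \<C>; B \<in> Ob \<C>; f \<in> Hom \<C> A B\<rbrakk> \<Longrightarrow>
      fmap F A B f \<in> Hom \<D> (fobj F B) (fobj F A)"
    and fmap_Ide: "\<And>A. A \<in> Ob \<C> \<Longrightarrow> fmap F A A (Ide \<C> A) = Ide \<D> (fobj F A)"
    and fmap_Cmp: "\<And>A B D f g.
      \<lbrakk>A \<in> Ob \<C>; B \<in> Ob \<C>; D \<in> Ob \<C>; f \<in> Hom \<C> A B; g \<in> Hom \<C> B D\<rbrakk> \<Longrightarrow>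
      fmap F A D (Cmp \<C> A B D g f) =
      Cmp \<D> (fobj F D) (fobj F B) (fobj F A) (fmap F A B f) (fmap F B D g)"

text \<open>The comodules whose carrier is a subset of the type \<open>'m\<close>, and similarly for right modules.\<close>

definition comodule_cat ::
  "('k, 'z) ring_scheme \<Rightarrow> ('k, 'c) coalgebra \<Rightarrow> (('k, 'm, 'c) comodule, 'm \<Rightarrow> 'm) cat"
  where "comodule_cat K C =
    \<lparr>Ob = {M. comodule K C M},
     Hom = comodule_maps K C,
     Cmp = (\<lambda>A B D g f. compose (carrier A) g f),
     Ide = (\<lambda>A. \<lambda>x\<in>carrier A. x)\<rparr>"

definition rmodule_cat ::
  "('r, 'z) ring_scheme \<Rightarrow> (('r, 'b) rmodule, 'b \<Rightarrow> 'b) cat"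
  where "rmodule_cat R =
    \<lparr>Ob = {X. right_module R X},
     Hom = rmodule_maps R,
     Cmp = (\<lambda>A B D g f. compose (carrier A) g f),
     Ide = (\<lambda>A. \<lambda>x\<in>carrier A. x)\<rparr>"

text \<open>Natural isomorphism of contravariant functors into right \<open>R\<close>-modules. The element types
  \<open>'b\<close> and \<open>'d\<close> of the values of the two functors may differ: they only determine in which type
  the underlying sets of the modules live.\<close>

definition naturally_isomorphic ::
  "('o, 'a) cat \<Rightarrow> ('r, 'z) ring_scheme
    \<Rightarrow> ('o, 'a, ('r, 'b) rmodule, 'b \<Rightarrow> 'b) functor_data
    \<Rightarrow> ('o, 'a, ('r, 'd) rmodule, 'd \<Rightarrow> 'd) functor_data \<Rightarrow> bool"
  where "naturally_isomorphic \<C> R F G \<longleftrightarrow>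
    (\<exists>\<eta>. (\<forall>M\<in>Ob \<C>. \<eta> M \<in> rmodule_iso R (fobj F M) (fobj G M)) \<and>
         (\<forall>M\<in>Ob \<C>. \<forall>N\<in>Ob \<C>. \<forall>f\<in>Hom \<C> M N.
            compose (carrier (fobj F N)) (\<eta> M) (fmap F M N f) =
            compose (carrier (fobj F N)) (fmap G M N f) (\<eta> N)))"

definition F_obj ::
  "('k, 'z) ring_scheme \<Rightarrow> ('k, 'c) coalgebra \<Rightarrow> ('k, 'm, 'c) comodule
    \<Rightarrow> ('c \<Rightarrow> 'k, 'm \<Rightarrow> 'k) rmodule"
  where "F_obj K C M =
    \<lparr>carrier = lin_maps K M (base_module K), mult = undefined, one = undefined,
     ring.zero = (\<lambda>m\<in>carrier M. \<zero>\<^bsub>K\<^esub>),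
     add = (\<lambda>g h. \<lambda>m\<in>carrier M. g m \<oplus>\<^bsub>K\<^esub> h m),
     ract = (\<lambda>g c. \<lambda>m\<in>carrier M. g (dual_left_act K C M c m))\<rparr>"

definition G_obj ::
  "('k, 'z) ring_scheme \<Rightarrow> ('k, 'c) coalgebra \<Rightarrow> ('k, 'm, 'c) comodule
    \<Rightarrow> ('c \<Rightarrow> 'k, 'm \<Rightarrow> 'c) rmodule"
  where "G_obj K C M =
    \<lparr>carrier = left_module_maps (dual_algebra K C)
                 (dual_left_module K C M) (dual_left_module K C (regular_comodule C)),
     mult = undefined, one = undefined,
     ring.zero = (\<lambda>m\<in>carrier M. \<zero>\<^bsub>C\<^esub>),
     add = (\<lambda>f h. \<lambda>m\<in>carrier M. f m \<oplus>\<^bsub>C\<^esub> h m),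
     ract = (\<lambda>f c. \<lambda>m\<in>carrier M. dual_right_act K C (f m) c)\<rparr>"

definition F_functor ::
  "('k, 'z) ring_scheme \<Rightarrow> ('k, 'c) coalgebra \<Rightarrow>
    (('k, 'm, 'c) comodule, 'm \<Rightarrow> 'm,
     ('c \<Rightarrow> 'k, 'm \<Rightarrow> 'k) rmodule, ('m \<Rightarrow> 'k) \<Rightarrow> ('m \<Rightarrow> 'k)) functor_data"
  where "F_functor K C =
    \<lparr>fobj = F_obj K C,
     fmap = (\<lambda>M N f. \<lambda>g\<in>carrier (F_obj K C N). compose (carrier M) g f)\<rparr>"

definition G_functor ::
  "('k, 'z) ring_scheme \<Rightarrow> ('k, 'c) coalgebra \<Rightarrow>
    (('k, 'm, 'c) comodule, 'm \<Rightarrow> 'm,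
     ('c \<Rightarrow> 'k, 'm \<Rightarrow> 'c) rmodule, ('m \<Rightarrow> 'c) \<Rightarrow> ('m \<Rightarrow> 'c)) functor_data"
  where "G_functor K C =
    \<lparr>fobj = G_obj K C,
     fmap = (\<lambda>M N f. \<lambda>g\<in>carrier (G_obj K C N). compose (carrier M) g f)\<rparr>"

end

theory Submission
  imports Defs
begin

text \<open>Write \<open>\<epsilon>\<close> for the counit, \<open>c \<cdot> m\<close> for the left action of \<open>C\<^sup>*\<close> on a comodule \<open>M\<close>, and \<open>x \<cdot> c\<close> for
  its right action on \<open>C\<close>. The isomorphism \<open>F(M) \<rightarrow> G(M)\<close> sends a functional \<open>g\<close> to the map
  \<open>m \<mapsto> \<Sum> g(m\<^sub>0) m\<^sub>1\<close> of matrix coefficients, and its inverse sends an equivariant map \<open>f\<close> to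
  \<open>\<epsilon> \<circ> f\<close>.

  The proof is a pairing argument. Functionals separate the points of the vector space \<open>C\<close>
  (\<open>functionals_separate\<close>, by Zorn's lemma), so an identity between elements of \<open>C\<close> may be
  checked after applying an arbitrary \<open>c\<close> in \<open>C\<^sup>*\<close>. Applied to a matrix coefficient, \<open>c\<close> gives
  \<open>c (\<Sum> g(m\<^sub>0) m\<^sub>1) = g (c \<cdot> m)\<close> (\<open>functional_coefficient\<close>). This turns left and right equivariance
  of the matrix coefficients into the module law \<open>(c d) \<cdot> m = c \<cdot> (d \<cdot> m)\<close> (\<open>act_mult\<close>), naturality
  in \<open>M\<close> into the fact that comodule maps commute with the action (\<open>comodule_map_act\<close>), and the
  identity \<open>f(m) = \<Sum> \<epsilon>(f(m\<^sub>0)) m\<^sub>1\<close> for equivariant \<open>f\<close> into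
  \<open>c (f m) = \<epsilon> (c \<cdot> f m) = \<epsilon> (f (c \<cdot> m))\<close>.

  The same identities for \<open>C\<close> as a comodule over itself provide the rest of the structure. The
  right action on \<open>C\<close> is the matrix coefficient map of the regular comodule, and the product of
  \<open>C\<^sup>*\<close> is \<open>c d = (x \<mapsto> c (d \<cdot> x))\<close>, so associativity of \<open>C\<^sup>*\<close> and the bimodule axioms are special
  cases of what is shown for comodules. Coassociativity enters only through the module law, whose proof
  needs that the tensor product is a module with its universal property.\<close>

section \<open>Linear and bilinear maps\<close>

text \<open>Linearity only constrains a map on the carrier, so that compositions and \<open>\<lambda>\<close>-terms with
  parameters can be used without restricting them; \<open>lin_maps\<close> consists of the extensional ones.\<close>

definition is_linear ::
  "('k, 'z) ring_scheme \<Rightarrow> ('k, 'm, 'u) module_scheme \<Rightarrow> ('k, 'n, 'v) module_scheme \<Rightarrow> ('m \<Rightarrow> 'n) \<Rightarrow> bool"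
  where "is_linear K M N f \<longleftrightarrow>
    (\<forall>x\<in>carrier M. f x \<in> carrier N) \<and>
    (\<forall>x\<in>carrier M. \<forall>y\<in>carrier M. f (x \<oplus>\<^bsub>M\<^esub> y) = f x \<oplus>\<^bsub>N\<^esub> f y) \<and>
    (\<forall>a\<in>carrier K. \<forall>x\<in>carrier M. f (a \<odot>\<^bsub>M\<^esub> x) = a \<odot>\<^bsub>N\<^esub> f x)"

definition is_bilinear ::
  "('k, 'z) ring_scheme \<Rightarrow> ('k, 'm, 'u) module_scheme \<Rightarrow> ('k, 'n, 'v) module_scheme
    \<Rightarrow> ('k, 'p, 'w) module_scheme \<Rightarrow> ('m \<Rightarrow> 'n \<Rightarrow> 'p) \<Rightarrow> bool"
  where "is_bilinear K M N P b \<longleftrightarrow>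
    (\<forall>x\<in>carrier M. is_linear K N P (b x)) \<and> (\<forall>y\<in>carrier N. is_linear K M P (\<lambda>x. b x y))"

lemma lin_maps_iff: "f \<in> lin_maps K M N \<longleftrightarrow> f \<in> extensional (carrier M) \<and> is_linear K M N f"
  by (auto simp: lin_maps_def is_linear_def PiE_def)

lemma is_linearI:
  assumes "\<And>x. x \<in> carrier M \<Longrightarrow> f x \<in> carrier N"
    and "\<And>x y. x \<in> carrier M \<Longrightarrow> y \<in> carrier M \<Longrightarrow> f (x \<oplus>\<^bsub>M\<^esub> y) = f x \<oplus>\<^bsub>N\<^esub> f y"
    and "\<And>a x. a \<in> carrier K \<Longrightarrow> x \<in> carrier M \<Longrightarrow> f (a \<odot>\<^bsub>M\<^esub> x) = a \<odot>\<^bsub>N\<^esub> f x"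
  shows "is_linear K M N f"
  using assms by (simp add: is_linear_def)

lemma is_linear_closed: "is_linear K M N f \<Longrightarrow> x \<in> carrier M \<Longrightarrow> f x \<in> carrier N"
  and is_linear_add: "is_linear K M N f \<Longrightarrow> x \<in> carrier M \<Longrightarrow> y \<in> carrier M \<Longrightarrow>
    f (x \<oplus>\<^bsub>M\<^esub> y) = f x \<oplus>\<^bsub>N\<^esub> f y"
  and is_linear_smult: "is_linear K M N f \<Longrightarrow> a \<in> carrier K \<Longrightarrow> x \<in> carrier M \<Longrightarrow>
    f (a \<odot>\<^bsub>M\<^esub> x) = a \<odot>\<^bsub>N\<^esub> f x"
  by (simp_all add: is_linear_def)

lemma is_linear_cong:
  assumes "module K M" "\<And>x. x \<in> carrier M \<Longrightarrow> f x = g x"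
  shows "is_linear K M N f \<longleftrightarrow> is_linear K M N g"
proof -
  interpret module K M by fact
  show ?thesis using assms(2) by (simp add: is_linear_def)
qed

lemma is_linear_comp:
  "is_linear K M N f \<Longrightarrow> is_linear K N P g \<Longrightarrow> is_linear K M P (\<lambda>x. g (f x))"
  by (simp add: is_linear_def)

lemma is_linear_zero:
  assumes "module K M" "module K N" "is_linear K M N f"
  shows "f \<zero>\<^bsub>M\<^esub> = \<zero>\<^bsub>N\<^esub>"
proof -
  interpret M: module K M by fact
  interpret N: module K N by fact
  show ?thesis
    using is_linear_smult[OF assms(3), of "\<zero>\<^bsub>K\<^esub>" "\<zero>\<^bsub>M\<^esub>"] is_linear_closed[OF assms(3), of "\<zero>\<^bsub>M\<^esub>"]
    by simp
qed

lemma is_linear_uminus: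
  assumes "module K M" "module K N" "is_linear K M N f" "x \<in> carrier M"
  shows "f (\<ominus>\<^bsub>M\<^esub> x) = \<ominus>\<^bsub>N\<^esub> f x"
proof -
  interpret M: module K M by fact
  interpret N: module K N by fact
  have "f (\<ominus>\<^bsub>M\<^esub> x) \<oplus>\<^bsub>N\<^esub> f x = \<zero>\<^bsub>N\<^esub>"
    using is_linear_add[OF assms(3), of "\<ominus>\<^bsub>M\<^esub> x" x] assms
    by (simp add: M.l_neg is_linear_zero[OF assms(1-3)])
  then show ?thesis
    using is_linear_closed[OF assms(3)] assms(4) by (simp add: N.minus_equality)
qed

lemma is_bilinear_left: "is_bilinear K M N P b \<Longrightarrow> y \<in> carrier N \<Longrightarrow> is_linear K M P (\<lambda>x. b x y)"
  and is_bilinear_right: "is_bilinear K M N P b \<Longrightarrow> x \<in> carrier M \<Longrightarrow> is_linear K N P (b x)"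
  by (simp_all add: is_bilinear_def)

lemma base_module_simps [simp]:
  "carrier (base_module K) = carrier K"
  "\<zero>\<^bsub>base_module K\<^esub> = \<zero>\<^bsub>K\<^esub>"
  "x \<oplus>\<^bsub>base_module K\<^esub> y = x \<oplus>\<^bsub>K\<^esub> y"
  "x \<odot>\<^bsub>base_module K\<^esub> y = x \<otimes>\<^bsub>K\<^esub> y"
  by (simp_all add: base_module_def)

lemma base_module_module:
  assumes "cring K" shows "module K (base_module K)"
proof -
  interpret cring K by fact
  have "abelian_group (base_module K)"
    by (rule abelian_groupI) (auto simp: a_ac intro: bexI[of _ "\<ominus>\<^bsub>K\<^esub> _"] l_neg)
  then show ?thesis
    by (intro moduleI is_cring) (auto simp: l_distr r_distr m_assoc)
qed

lemma is_linear_pointwise_add: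
  assumes "module K M" "module K N" "is_linear K M N f" "is_linear K M N g"
  shows "is_linear K M N (\<lambda>x. f x \<oplus>\<^bsub>N\<^esub> g x)"
proof -
  interpret N: module K N by fact
  show ?thesis
    using is_linear_closed[OF assms(3)] is_linear_closed[OF assms(4)]
    by (intro is_linearI)
      (simp_all add: is_linear_add[OF assms(3)] is_linear_add[OF assms(4)] N.a_ac N.smult_r_distr
        is_linear_smult[OF assms(3)] is_linear_smult[OF assms(4)])
qed

lemma is_linear_pointwise_uminus:
  assumes "module K M" "module K N" "is_linear K M N f"
  shows "is_linear K M N (\<lambda>x. \<ominus>\<^bsub>N\<^esub> f x)"
proof -
  interpret N: module K N by fact
  show ?thesis
    using is_linear_closed[OF assms(3)]
    by (intro is_linearI)
      (simp_all add: is_linear_add[OF assms(3)] is_linear_smult[OF assms(3)] N.minus_add N.smult_r_minus N.a_comm)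
qed

lemma is_linear_const_zero:
  assumes "module K N" shows "is_linear K M N (\<lambda>x. \<zero>\<^bsub>N\<^esub>)"
proof -
  interpret N: module K N by fact
  show ?thesis by (rule is_linearI) simp_all
qed

lemma is_linear_functional_smult:
  assumes "module K M" "module K N" "is_linear K M (base_module K) c" "y \<in> carrier N"
  shows "is_linear K M N (\<lambda>x. c x \<odot>\<^bsub>N\<^esub> y)"
proof -
  interpret N: module K N by fact
  show ?thesis
    using assms(4) is_linear_closed[OF assms(3)]
    by (intro is_linearI)
      (simp_all add: is_linear_add[OF assms(3)] is_linear_smult[OF assms(3)] N.smult_l_distr N.smult_assoc1)
qed

lemma is_linear_scale:
  assumes "module K M" "a \<in> carrier K"
  shows "is_linear K M M (\<lambda>x. a \<odot>\<^bsub>M\<^esub> x)"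
proof -
  interpret M: module K M by fact
  have "a \<odot>\<^bsub>M\<^esub> (b \<odot>\<^bsub>M\<^esub> x) = b \<odot>\<^bsub>M\<^esub> (a \<odot>\<^bsub>M\<^esub> x)" if "b \<in> carrier K" "x \<in> carrier M" for b x
    using that assms(2) by (metis M.smult_assoc1 M.m_comm)
  then show ?thesis using assms(2) by (intro is_linearI) (simp_all add: M.smult_r_distr)
qed

lemma is_bilinear_functional_left:
  assumes "module K M" "module K N" "is_linear K M (base_module K) c"
  shows "is_bilinear K M N N (\<lambda>x y. c x \<odot>\<^bsub>N\<^esub> y)"
  unfolding is_bilinear_def
  using is_linear_functional_smult[OF assms] is_linear_scale[OF assms(2)] is_linear_closed[OF assms(3)]
  by simp

lemma is_bilinear_functional_right:
  assumes "module K M" "module K N" "is_linear K N (base_module K) c"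
  shows "is_bilinear K M N M (\<lambda>x y. c y \<odot>\<^bsub>M\<^esub> x)"
  unfolding is_bilinear_def
  using is_linear_functional_smult[OF assms(2,1,3)] is_linear_scale[OF assms(1)] is_linear_closed[OF assms(3)]
  by simp

lemma is_bilinear_comp:
  "is_bilinear K M N P b \<Longrightarrow> is_linear K P Q f \<Longrightarrow> is_bilinear K M N Q (\<lambda>x y. f (b x y))"
  by (auto simp: is_bilinear_def intro: is_linear_comp[where g = f])

lemma is_bilinear_comp_args:
  assumes "is_bilinear K P Q R b" "is_linear K M P f" "is_linear K N Q g"
  shows "is_bilinear K M N R (\<lambda>x y. b (f x) (g y))"
  unfolding is_bilinear_def
proof (intro conjI ballI)
  show "is_linear K N R (\<lambda>y. b (f x) (g y))" if "x \<in> carrier M" for x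
    by (rule is_linear_comp[OF assms(3) is_bilinear_right[OF assms(1) is_linear_closed[OF assms(2) that]]])
  show "is_linear K M R (\<lambda>x. b (f x) (g y))" if "y \<in> carrier N" for y
    by (rule is_linear_comp[OF assms(2) is_bilinear_left[OF assms(1) is_linear_closed[OF assms(3) that]]])
qed

lemma is_linear_id: "is_linear K M M (\<lambda>x. x)"
  by (simp add: is_linear_def)

lemma is_linear_restrict_id:
  assumes "module K M"
  shows "is_linear K M M (\<lambda>x\<in>carrier M. x)"
  by (subst is_linear_cong[OF assms, where g = "\<lambda>x. x"]) (simp_all add: is_linear_id)

lemma restrict_mem_lin_maps:
  assumes "module K M" "is_linear K M N f"
  shows "(\<lambda>x\<in>carrier M. f x) \<in> lin_maps K M N"
  using assms by (simp add: lin_maps_iff is_linear_cong[OF assms(1), of "restrict f (carrier M)" f])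

lemma (in abelian_monoid) add_middle_swap:
  assumes "a \<in> carrier G" "b \<in> carrier G" "c \<in> carrier G" "d \<in> carrier G"
  shows "(a \<oplus> b) \<oplus> (c \<oplus> d) = (a \<oplus> c) \<oplus> (b \<oplus> d)"
  using assms by (simp add: a_ac)

text \<open>Used for the additive groups of the dual algebra and of both right modules, whose elements
  are functions added pointwise.\<close>

lemma pointwise_abelian_group:
  assumes P: "abelian_group P" and val: "\<And>f s. f \<in> carrier X \<Longrightarrow> s \<in> S \<Longrightarrow> f s \<in> carrier P"
    and ext: "\<And>f. f \<in> carrier X \<Longrightarrow> f \<in> extensional S"
    and zero: "\<zero>\<^bsub>X\<^esub> = (\<lambda>s\<in>S. \<zero>\<^bsub>P\<^esub>)"
    and add: "\<And>f g. f \<oplus>\<^bsub>X\<^esub> g = (\<lambda>s\<in>S. f s \<oplus>\<^bsub>P\<^esub> g s)"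
    and zero_closed: "(\<lambda>s\<in>S. \<zero>\<^bsub>P\<^esub>) \<in> carrier X"
    and add_closed: "\<And>f g. f \<in> carrier X \<Longrightarrow> g \<in> carrier X \<Longrightarrow> (\<lambda>s\<in>S. f s \<oplus>\<^bsub>P\<^esub> g s) \<in> carrier X"
    and uminus_closed: "\<And>f. f \<in> carrier X \<Longrightarrow> (\<lambda>s\<in>S. \<ominus>\<^bsub>P\<^esub> f s) \<in> carrier X"
  shows "abelian_group X"
proof -
  interpret P: abelian_group P by (rule P)
  show ?thesis
  proof (rule abelian_groupI)
    show "\<exists>g\<in>carrier X. g \<oplus>\<^bsub>X\<^esub> f = \<zero>\<^bsub>X\<^esub>" if "f \<in> carrier X" for f
      by (rule bexI[OF _ uminus_closed[OF that]])
        (auto simp: add zero val[OF that] P.l_neg)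
    show "\<zero>\<^bsub>X\<^esub> \<oplus>\<^bsub>X\<^esub> f = f" if "f \<in> carrier X" for f
      using val[OF that] ext[OF that] by (auto simp: add zero extensional_def)
  qed (auto simp: add zero zero_closed add_closed val P.a_ac)
qed

lemma lin_maps_pointwise_abelian_group:
  assumes M: "module K M" and N: "module K N" and X: "carrier X = lin_maps K M N"
    and zero: "\<zero>\<^bsub>X\<^esub> = (\<lambda>x\<in>carrier M. \<zero>\<^bsub>N\<^esub>)"
    and add: "\<And>f g. f \<oplus>\<^bsub>X\<^esub> g = (\<lambda>x\<in>carrier M. f x \<oplus>\<^bsub>N\<^esub> g x)"
  shows "abelian_group X"
proof (rule pointwise_abelian_group[OF _ _ _ zero add])
  interpret N: module K N by (rule N)
  show "abelian_group N" by (rule N.M.abelian_group_axioms)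
  show "(\<lambda>x\<in>carrier M. \<zero>\<^bsub>N\<^esub>) \<in> carrier X"
    unfolding X by (rule restrict_mem_lin_maps[OF M is_linear_const_zero[OF N]])
  show "(\<lambda>x\<in>carrier M. f x \<oplus>\<^bsub>N\<^esub> g x) \<in> carrier X" if "f \<in> carrier X" "g \<in> carrier X" for f g
    using that unfolding X
    by (intro restrict_mem_lin_maps[OF M] is_linear_pointwise_add[OF M N]) (simp_all add: lin_maps_iff)
  show "(\<lambda>x\<in>carrier M. \<ominus>\<^bsub>N\<^esub> f x) \<in> carrier X" if "f \<in> carrier X" for f
    using that unfolding X
    by (intro restrict_mem_lin_maps[OF M] is_linear_pointwise_uminus[OF M N]) (simp add: lin_maps_iff)
qed (auto simp: X lin_maps_iff intro: is_linear_closed)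

section \<open>The tensor product\<close>

locale tensor_product = M: module K M + N: module K N
  for K :: "('k, 'z) ring_scheme"
    and M :: "('k, 'm, 'u) module_scheme" and N :: "('k, 'n, 'v) module_scheme"
begin

abbreviation "pairs \<equiv> carrier M \<times> carrier N"

definition cls :: "('m \<times> 'n \<Rightarrow>\<^sub>0 int) \<Rightarrow> ('m, 'n) tens"
  where "cls u = tensor_null K M N #>\<^bsub>tensor_free M N\<^esub> u"

definition scale :: "'k \<Rightarrow> ('m \<times> 'n \<Rightarrow>\<^sub>0 int) \<Rightarrow> ('m \<times> 'n \<Rightarrow>\<^sub>0 int)"
  where "scale a = frag_extend (\<lambda>(x, y). frag_of (a \<odot>\<^bsub>M\<^esub> x, y))"

lemma free_comm_group: "comm_group (tensor_free M N)"
  by (simp add: tensor_free_def abelian_free_Abelian_group)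

lemma free_simps [simp]:
  "x \<in> carrier (tensor_free M N) \<longleftrightarrow> Poly_Mapping.keys x \<subseteq> pairs"
  "\<one>\<^bsub>tensor_free M N\<^esub> = 0"
  "x \<otimes>\<^bsub>tensor_free M N\<^esub> y = x + y"
  by (simp_all add: tensor_free_def)

lemma free_inv [simp]: "Poly_Mapping.keys x \<subseteq> pairs \<Longrightarrow> inv\<^bsub>tensor_free M N\<^esub> x = - x"
  by (simp add: tensor_free_def)

lemma keys_add_pairs: "Poly_Mapping.keys u \<subseteq> pairs \<Longrightarrow> Poly_Mapping.keys v \<subseteq> pairs \<Longrightarrow> Poly_Mapping.keys (u + v) \<subseteq> pairs"
  for u v :: "'m \<times> 'n \<Rightarrow>\<^sub>0 int"
  using Poly_Mapping.keys_add[of u v] by blast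

lemma keys_diff_pairs: "Poly_Mapping.keys u \<subseteq> pairs \<Longrightarrow> Poly_Mapping.keys v \<subseteq> pairs \<Longrightarrow> Poly_Mapping.keys (u - v) \<subseteq> pairs"
  for u v :: "'m \<times> 'n \<Rightarrow>\<^sub>0 int"
  using keys_diff[of u v] by blast

lemma relations_in_free: "tensor_relations K M N \<subseteq> carrier (tensor_free M N)"
  unfolding tensor_relations_def by (auto dest!: subsetD[OF keys_diff])

lemma null_subgroup: "subgroup (tensor_null K M N) (tensor_free M N)"
  unfolding tensor_null_def
  using group.generate_is_subgroup[OF _ relations_in_free] free_comm_group
  by (simp add: comm_group.axioms(2))

lemma null_normal: "tensor_null K M N \<lhd> tensor_free M N"
  using comm_group.normal_iff_subgroup[OF free_comm_group] null_subgroup by blast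

lemma null_keys: "u \<in> tensor_null K M N \<Longrightarrow> Poly_Mapping.keys u \<subseteq> pairs"
  using subsetD[OF subgroup.subset[OF null_subgroup]] free_simps(1) by blast

lemma null_zero: "0 \<in> tensor_null K M N"
  using subgroup.one_closed[OF null_subgroup] by simp

lemma null_add: "u \<in> tensor_null K M N \<Longrightarrow> v \<in> tensor_null K M N \<Longrightarrow> u + v \<in> tensor_null K M N"
  using subgroup.m_closed[OF null_subgroup] by simp

lemma null_uminus: "u \<in> tensor_null K M N \<Longrightarrow> - u \<in> tensor_null K M N"
  using subgroup.m_inv_closed[OF null_subgroup, of u] null_keys by simp

lemma null_diff: "u \<in> tensor_null K M N \<Longrightarrow> v \<in> tensor_null K M N \<Longrightarrow> u - v \<in> tensor_null K M N"
  using null_add[of u "- v"] null_uminus[of v] by simp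

lemma null_relation: "u \<in> tensor_relations K M N \<Longrightarrow> u \<in> tensor_null K M N"
  by (simp add: tensor_null_def generate.incl)

text \<open>A set closed under differences and containing 0 is a subgroup, so elements of the null
  subgroup can be reached from 0 and the defining relations by differences alone.\<close>

lemma null_induct [consumes 1, case_names relation zero diff]:
  assumes "u \<in> tensor_null K M N"
    and "\<And>u. u \<in> tensor_relations K M N \<Longrightarrow> P u"
    and "P 0"
    and "\<And>u v. u \<in> tensor_null K M N \<Longrightarrow> v \<in> tensor_null K M N \<Longrightarrow> P u \<Longrightarrow> P v \<Longrightarrow> P (u - v)"
  shows "P u"
proof -
  define H where "H = {u \<in> tensor_null K M N. P u}"
  have add: "u + v \<in> H" if "u \<in> H" "v \<in> H" for u v
  proof -
    have "P (0 - v)" using that assms(3,4) null_zero unfolding H_def by blast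
    then have "P (u - (0 - v))" using that assms(4)[of u "0 - v"] null_uminus[of v]
      unfolding H_def by simp
    then show ?thesis using that null_add unfolding H_def by simp
  qed
  have minus: "- u \<in> H" if "u \<in> H" for u
    using that assms(3) assms(4)[of 0 u] null_zero null_uminus[of u] unfolding H_def by simp
  have "subgroup H (tensor_free M N)"
    by (rule subgroup.intro)
      (use assms(3) null_zero null_keys add minus in \<open>auto simp: H_def\<close>)
  moreover have "tensor_relations K M N \<subseteq> H"
    using assms(2) null_relation by (auto simp: H_def)
  ultimately have "tensor_null K M N \<subseteq> H"
    unfolding tensor_null_def
    by (rule group.generate_subgroup_incl[OF comm_group.axioms(2)[OF free_comm_group], rotated])
  then show ?thesis using assms(1) by (auto simp: H_def)
qed

lemma mem_cls_iff: "v \<in> cls u \<longleftrightarrow> v - u \<in> tensor_null K M N"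
  by (auto simp: cls_def r_coset_def intro!: bexI[of _ "v - u"])

lemma cls_eq_iff: "cls u = cls v \<longleftrightarrow> u - v \<in> tensor_null K M N"
proof
  assume "cls u = cls v"
  then have "u \<in> cls v" using null_zero by (auto simp flip: \<open>cls u = cls v\<close> simp: mem_cls_iff)
  then show "u - v \<in> tensor_null K M N" by (simp add: mem_cls_iff)
next
  assume *: "u - v \<in> tensor_null K M N"
  have "w - u \<in> tensor_null K M N \<longleftrightarrow> w - v \<in> tensor_null K M N" for w
    using null_add[OF _ *, of "w - u"] null_diff[OF _ *, of "w - v"] by auto
  then show "cls u = cls v" by (auto simp: mem_cls_iff)
qed

lemma carrier_tensor: "carrier (tensor K M N) = {cls u |u. Poly_Mapping.keys u \<subseteq> pairs}"
  by (auto simp: tensor_def Let_def carrier_FactGroup cls_def)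

lemma cls_closed: "Poly_Mapping.keys u \<subseteq> pairs \<Longrightarrow> cls u \<in> carrier (tensor K M N)"
  by (auto simp: carrier_tensor)

lemma tensorE:
  assumes "t \<in> carrier (tensor K M N)"
  obtains u where "t = cls u" "Poly_Mapping.keys u \<subseteq> pairs"
  using assms by (auto simp: carrier_tensor)

lemma zero_tensor: "\<zero>\<^bsub>tensor K M N\<^esub> = cls 0"
  by (auto simp: tensor_def Let_def mem_cls_iff)

lemma add_tensor:
  assumes "Poly_Mapping.keys u \<subseteq> pairs" "Poly_Mapping.keys v \<subseteq> pairs"
  shows "cls u \<oplus>\<^bsub>tensor K M N\<^esub> cls v = cls (u + v)"
  using normal.rcos_sum[OF null_normal, of u v] assms
  by (simp add: tensor_def Let_def cls_def)

lemma keys_scale: "a \<in> carrier K \<Longrightarrow> Poly_Mapping.keys u \<subseteq> pairs \<Longrightarrow> Poly_Mapping.keys (scale a u) \<subseteq> pairs"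
  unfolding scale_def
  by (rule order_trans[OF keys_frag_extend]) (auto simp: split_def keys_frag_of)

lemma scale_diff: "scale a (u - v) = scale a u - scale a v"
  by (simp add: scale_def frag_extend_diff)

lemma scale_add: "scale a (u + v) = scale a u + scale a v"
  by (simp add: scale_def frag_extend_add)

text \<open>Each defining relation is mapped by \<open>scale a\<close> to a relation of the same kind; for the balancing
  relation this uses commutativity of \<open>K\<close>. Hence scalar multiplication is well defined on cosets.\<close>

lemma scale_null:
  assumes a: "a \<in> carrier K" and u: "u \<in> tensor_null K M N"
  shows "scale a u \<in> tensor_null K M N"
  using u
proof (induction u rule: null_induct)
  case (relation u)
  then consider
      (l) x x' y where "u = frag_of (x \<oplus>\<^bsub>M\<^esub> x', y) - frag_of (x, y) - frag_of (x', y)"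
        "x \<in> carrier M" "x' \<in> carrier M" "y \<in> carrier N"
    | (r) x y y' where "u = frag_of (x, y \<oplus>\<^bsub>N\<^esub> y') - frag_of (x, y) - frag_of (x, y')"
        "x \<in> carrier M" "y \<in> carrier N" "y' \<in> carrier N"
    | (s) b x y where "u = frag_of (b \<odot>\<^bsub>M\<^esub> x, y) - frag_of (x, b \<odot>\<^bsub>N\<^esub> y)"
        "b \<in> carrier K" "x \<in> carrier M" "y \<in> carrier N"
    unfolding tensor_relations_def by blast
  then have "scale a u \<in> tensor_relations K M N"
  proof cases
    case l
    then have "scale a u = frag_of (a \<odot>\<^bsub>M\<^esub> x \<oplus>\<^bsub>M\<^esub> a \<odot>\<^bsub>M\<^esub> x', y)
        - frag_of (a \<odot>\<^bsub>M\<^esub> x, y) - frag_of (a \<odot>\<^bsub>M\<^esub> x', y)"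
      using a by (simp add: scale_def frag_extend_diff M.smult_r_distr)
    moreover have "a \<odot>\<^bsub>M\<^esub> x \<in> carrier M" "a \<odot>\<^bsub>M\<^esub> x' \<in> carrier M" using l a by auto
    ultimately show ?thesis using l unfolding tensor_relations_def by blast
  next
    case r
    then have "scale a u = frag_of (a \<odot>\<^bsub>M\<^esub> x, y \<oplus>\<^bsub>N\<^esub> y')
        - frag_of (a \<odot>\<^bsub>M\<^esub> x, y) - frag_of (a \<odot>\<^bsub>M\<^esub> x, y')"
      by (simp add: scale_def frag_extend_diff)
    moreover have "a \<odot>\<^bsub>M\<^esub> x \<in> carrier M" using r a by auto
    ultimately show ?thesis using r unfolding tensor_relations_def by blast
  next
    case s
    have "a \<odot>\<^bsub>M\<^esub> (b \<odot>\<^bsub>M\<^esub> x) = b \<odot>\<^bsub>M\<^esub> (a \<odot>\<^bsub>M\<^esub> x)"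
      using s a by (metis M.smult_assoc1 M.m_comm)
    then have "scale a u = frag_of (b \<odot>\<^bsub>M\<^esub> (a \<odot>\<^bsub>M\<^esub> x), y) - frag_of (a \<odot>\<^bsub>M\<^esub> x, b \<odot>\<^bsub>N\<^esub> y)"
      using s by (simp add: scale_def frag_extend_diff)
    moreover have "a \<odot>\<^bsub>M\<^esub> x \<in> carrier M" using s a by auto
    ultimately show ?thesis using s unfolding tensor_relations_def by blast
  qed
  then show ?case by (rule null_relation)
next
  case zero
  then show ?case by (simp add: scale_def null_zero)
next
  case (diff u v)
  then show ?case by (simp add: scale_diff null_diff)
qed

lemma smult_tensor:
  assumes "a \<in> carrier K" "Poly_Mapping.keys u \<subseteq> pairs"
  shows "a \<odot>\<^bsub>tensor K M N\<^esub> cls u = cls (scale a u)"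
proof -
  have "cls (scale a v) = cls (scale a u)" if "v \<in> cls u" for v
    using that scale_null[OF assms(1)] by (simp add: mem_cls_iff cls_eq_iff flip: scale_diff)
  moreover have "u \<in> cls u" by (simp add: mem_cls_iff null_zero)
  moreover have "a \<odot>\<^bsub>tensor K M N\<^esub> cls u = (\<Union>v\<in>cls u. cls (scale a v))"
    by (simp add: tensor_def Let_def cls_def scale_def)
  ultimately show ?thesis by blast
qed

lemma pure_tensor_cls: "pure_tensor K M N x y = cls (frag_of (x, y))"
  by (simp add: pure_tensor_def cls_def)

lemma tensor_abelian_group: "abelian_group (tensor K M N)"
proof (rule abelian_groupI)
  show "\<exists>y\<in>carrier (tensor K M N). y \<oplus>\<^bsub>tensor K M N\<^esub> x = \<zero>\<^bsub>tensor K M N\<^esub>"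
    if x: "x \<in> carrier (tensor K M N)" for x
  proof -
    obtain u where u: "x = cls u" "Poly_Mapping.keys u \<subseteq> pairs" using x by (auto simp: carrier_tensor)
    then have "cls (- u) \<oplus>\<^bsub>tensor K M N\<^esub> x = \<zero>\<^bsub>tensor K M N\<^esub>"
      by (simp add: add_tensor zero_tensor)
    moreover have "cls (- u) \<in> carrier (tensor K M N)" using u by (simp add: cls_closed)
    ultimately show ?thesis by blast
  qed
qed (auto elim!: tensorE simp: cls_closed add_tensor zero_tensor keys_add_pairs ac_simps)

text \<open>Only additivity in the scalar uses the relations: \<open>(a + b) x \<otimes> y\<close> and
  \<open>a x \<otimes> y + b x \<otimes> y\<close> come from different elements of the free group. The other axioms
  already hold there.\<close>

lemma tensor_module: "module K (tensor K M N)"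
proof (rule moduleI)
  show "cring K" by (rule M.is_cring)
  show "abelian_group (tensor K M N)" by (rule tensor_abelian_group)
  show "a \<odot>\<^bsub>tensor K M N\<^esub> t \<in> carrier (tensor K M N)"
    if "a \<in> carrier K" "t \<in> carrier (tensor K M N)" for a t
    using that keys_scale by (auto elim!: tensorE simp: smult_tensor cls_closed)
  show "(a \<oplus>\<^bsub>K\<^esub> b) \<odot>\<^bsub>tensor K M N\<^esub> t =
      a \<odot>\<^bsub>tensor K M N\<^esub> t \<oplus>\<^bsub>tensor K M N\<^esub> b \<odot>\<^bsub>tensor K M N\<^esub> t"
    if ab: "a \<in> carrier K" "b \<in> carrier K" and t: "t \<in> carrier (tensor K M N)" for a b t
  proof -
    have "scale (a \<oplus>\<^bsub>K\<^esub> b) u - scale a u - scale b u \<in> tensor_null K M N"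
      if "Poly_Mapping.keys u \<subseteq> pairs" for u
      using that
    proof (induction u rule: frag_induction)
      case (one u)
      then obtain x y where u: "u = (x, y)" "x \<in> carrier M" "y \<in> carrier N" by blast
      have "frag_of (a \<odot>\<^bsub>M\<^esub> x \<oplus>\<^bsub>M\<^esub> b \<odot>\<^bsub>M\<^esub> x, y) - frag_of (a \<odot>\<^bsub>M\<^esub> x, y) - frag_of (b \<odot>\<^bsub>M\<^esub> x, y)
          \<in> tensor_relations K M N"
        using u ab unfolding tensor_relations_def by blast
      then show ?case using u ab by (simp add: scale_def M.smult_l_distr null_relation)
    next
      case (diff u v)
      then show ?case
        using null_diff[of "scale (a \<oplus>\<^bsub>K\<^esub> b) u - scale a u - scale b u"
            "scale (a \<oplus>\<^bsub>K\<^esub> b) v - scale a v - scale b v"]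
        by (simp add: scale_diff algebra_simps)
    qed (simp add: scale_def null_zero)
    then show ?thesis
      using ab t
      by (elim tensorE) (simp add: smult_tensor add_tensor keys_scale cls_eq_iff diff_diff_eq)
  qed
  show "a \<odot>\<^bsub>tensor K M N\<^esub> (t \<oplus>\<^bsub>tensor K M N\<^esub> s) =
      a \<odot>\<^bsub>tensor K M N\<^esub> t \<oplus>\<^bsub>tensor K M N\<^esub> a \<odot>\<^bsub>tensor K M N\<^esub> s"
    if "a \<in> carrier K" "t \<in> carrier (tensor K M N)" "s \<in> carrier (tensor K M N)" for a t s
    using that
    by (elim tensorE) (simp add: smult_tensor add_tensor keys_scale keys_add_pairs scale_add)
  show "(a \<otimes>\<^bsub>K\<^esub> b) \<odot>\<^bsub>tensor K M N\<^esub> t = a \<odot>\<^bsub>tensor K M N\<^esub> (b \<odot>\<^bsub>tensor K M N\<^esub> t)"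
    if ab: "a \<in> carrier K" "b \<in> carrier K" and t: "t \<in> carrier (tensor K M N)" for a b t
  proof -
    have "scale (a \<otimes>\<^bsub>K\<^esub> b) u = scale a (scale b u)" if "Poly_Mapping.keys u \<subseteq> pairs" for u
      using that
      by (induction u rule: frag_induction) (use ab in \<open>auto simp: scale_def M.smult_assoc1 frag_extend_diff\<close>)
    then show ?thesis using ab t by (auto elim!: tensorE simp: smult_tensor keys_scale)
  qed
  show "\<one>\<^bsub>K\<^esub> \<odot>\<^bsub>tensor K M N\<^esub> t = t" if t: "t \<in> carrier (tensor K M N)" for t
  proof -
    have "scale \<one>\<^bsub>K\<^esub> u = u" if "Poly_Mapping.keys u \<subseteq> pairs" for u
      using that
      by (induction u rule: frag_induction) (auto simp: scale_def frag_extend_diff)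
    then show ?thesis using t by (auto elim!: tensorE simp: smult_tensor)
  qed
qed

lemma pure_tensor_bilinear: "is_bilinear K M N (tensor K M N) (pure_tensor K M N)"
proof -
  interpret T: module K "tensor K M N" by (rule tensor_module)
  have l: "cls (frag_of (x \<oplus>\<^bsub>M\<^esub> x', y)) = cls (frag_of (x, y) + frag_of (x', y))"
    if "x \<in> carrier M" "x' \<in> carrier M" "y \<in> carrier N" for x x' y
    unfolding cls_eq_iff using that
    by (intro null_relation) (unfold tensor_relations_def diff_diff_eq[symmetric], blast)
  have r: "cls (frag_of (x, y \<oplus>\<^bsub>N\<^esub> y')) = cls (frag_of (x, y) + frag_of (x, y'))"
    if "x \<in> carrier M" "y \<in> carrier N" "y' \<in> carrier N" for x y y'
    unfolding cls_eq_iff using that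
    by (intro null_relation) (unfold tensor_relations_def diff_diff_eq[symmetric], blast)
  have s: "cls (frag_of (a \<odot>\<^bsub>M\<^esub> x, y)) = cls (frag_of (x, a \<odot>\<^bsub>N\<^esub> y))"
    if "a \<in> carrier K" "x \<in> carrier M" "y \<in> carrier N" for a x y
    unfolding cls_eq_iff using that
    by (intro null_relation) (unfold tensor_relations_def, blast)
  have c: "cls (frag_of (x, y)) \<in> carrier (tensor K M N)"
    if "x \<in> carrier M" "y \<in> carrier N" for x y
    using that by (simp add: cls_closed)
  have m: "a \<odot>\<^bsub>tensor K M N\<^esub> cls (frag_of (x, y)) = cls (frag_of (a \<odot>\<^bsub>M\<^esub> x, y))"
    if "a \<in> carrier K" "x \<in> carrier M" "y \<in> carrier N" for a x y
    using that by (simp add: smult_tensor scale_def)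
  show ?thesis
    unfolding is_bilinear_def
    by (intro conjI ballI is_linearI) (simp_all add: pure_tensor_cls l r c m s add_tensor)
qed

lemma tensor_induct [consumes 1, case_names pure minus]:
  assumes t: "t \<in> carrier (tensor K M N)"
    and pure: "\<And>x y. x \<in> carrier M \<Longrightarrow> y \<in> carrier N \<Longrightarrow> P (pure_tensor K M N x y)"
    and minus: "\<And>t s. t \<in> carrier (tensor K M N) \<Longrightarrow> s \<in> carrier (tensor K M N) \<Longrightarrow> P t \<Longrightarrow> P s \<Longrightarrow>
      P (t \<oplus>\<^bsub>tensor K M N\<^esub> \<ominus>\<^bsub>tensor K M N\<^esub> s)"
  shows "P t"
proof -
  interpret T: module K "tensor K M N" by (rule tensor_module)
  have uminus_cls: "\<ominus>\<^bsub>tensor K M N\<^esub> cls u = cls (- u)" if "Poly_Mapping.keys u \<subseteq> pairs" for u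
    by (rule T.minus_equality) (use that in \<open>auto simp: cls_closed add_tensor zero_tensor\<close>)
  have z: "P (cls 0)"
  proof -
    let ?t = "cls (frag_of (\<zero>\<^bsub>M\<^esub>, \<zero>\<^bsub>N\<^esub>))"
    \<comment> \<open>Zero is obtained as the difference of a pure tensor with itself.\<close>
    have c: "?t \<in> carrier (tensor K M N)" by (simp add: cls_closed)
    have p: "P ?t" using pure[of "\<zero>\<^bsub>M\<^esub>" "\<zero>\<^bsub>N\<^esub>"] by (simp add: pure_tensor_cls)
    show ?thesis using minus[OF c c p p] c by (simp add: T.r_neg zero_tensor)
  qed
  have "P (cls u)" if "Poly_Mapping.keys u \<subseteq> pairs" for u
    using that
  proof (induction u rule: free_Abelian_group_induct[consumes 1, case_names zero diff single])
    case zero then show ?case by (rule z)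
  next
    case (diff u v)
    have "cls u \<in> carrier (tensor K M N)" "cls v \<in> carrier (tensor K M N)"
      using diff by (simp_all add: cls_closed)
    from minus[OF this diff(3,4)] show ?case
      using diff(1,2) by (simp add: uminus_cls add_tensor)
  next
    case (single a) then show ?case using pure by (auto simp: pure_tensor_cls)
  qed
  then show ?thesis using t by (auto elim: tensorE)
qed

text \<open>Pure tensors generate, so a linear map is determined by its values on them.\<close>

lemma linear_on_tensor_eqI:
  assumes P: "module K P" and f: "is_linear K (tensor K M N) P f" and g: "is_linear K (tensor K M N) P g"
    and eq: "\<And>x y. x \<in> carrier M \<Longrightarrow> y \<in> carrier N \<Longrightarrow> f (pure_tensor K M N x y) = g (pure_tensor K M N x y)"
    and t: "t \<in> carrier (tensor K M N)"
  shows "f t = g t"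
proof -
  interpret T: module K "tensor K M N" by (rule tensor_module)
  show ?thesis
    using t
  proof (induction t rule: tensor_induct)
    case (minus t s)
    then show ?case
      by (simp add: is_linear_add[OF f] is_linear_add[OF g]
          is_linear_uminus[OF tensor_module P f] is_linear_uminus[OF tensor_module P g])
  qed (rule eq)
qed

text \<open>The homomorphism from the free group that sends a generator \<open>(x, y)\<close> to \<open>b x y\<close> kills the
  defining relations because \<open>b\<close> is bilinear, so it factors through the quotient.\<close>

lemma bilinear_extends:
  assumes P: "module K P" and b: "is_bilinear K M N P b"
  shows "\<exists>h\<in>lin_maps K (tensor K M N) P.
    \<forall>x\<in>carrier M. \<forall>y\<in>carrier N. h (pure_tensor K M N x y) = b x y"
proof -
  interpret P: module K P by (rule P)
  interpret T: module K "tensor K M N" by (rule tensor_module)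
  note bl = is_bilinear_left[OF b] and br = is_bilinear_right[OF b]
  have closed: "b x y \<in> carrier P" if "x \<in> carrier M" "y \<in> carrier N" for x y
    using is_linear_closed[OF br] that by blast
  have "(\<lambda>(x, y). b x y) ` pairs \<subseteq> carrier (add_monoid P)" using closed by auto
  from comm_group.free_Abelian_group_universal[OF P.a_comm_group this]
  obtain h where hom: "h \<in> hom (tensor_free M N) (add_monoid P)"
    and h: "\<And>z. z \<in> pairs \<Longrightarrow> h (frag_of z) = (\<lambda>(x, y). b x y) z"
    unfolding tensor_free_def by blast
  have hc: "h u \<in> carrier P" if "Poly_Mapping.keys u \<subseteq> pairs" for u
    using hom that by (auto simp: hom_def)
  have hadd: "h (u + v) = h u \<oplus>\<^bsub>P\<^esub> h v"
    if "Poly_Mapping.keys u \<subseteq> pairs" "Poly_Mapping.keys v \<subseteq> pairs" for u v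
    using hom that by (auto simp: hom_def)
  have hdiff: "h (u - v) = h u \<ominus>\<^bsub>P\<^esub> h v"
    if "Poly_Mapping.keys u \<subseteq> pairs" "Poly_Mapping.keys v \<subseteq> pairs" for u v
  proof -
    have "h u = h (u - v) \<oplus>\<^bsub>P\<^esub> h v" using hadd[of "u - v" v] that keys_diff_pairs by simp
    then show ?thesis
      using hc[of v] hc[of "u - v"] that keys_diff_pairs[of u v] by (simp add: P.minus_eq P.a_assoc P.r_neg)
  qed
  have h0: "h 0 = \<zero>\<^bsub>P\<^esub>" using hdiff[of 0 0] hc[of 0] by (simp add: P.minus_eq P.r_neg)
  have hnull: "h u = \<zero>\<^bsub>P\<^esub>" if "u \<in> tensor_null K M N" for u
    using that
  proof (induction u rule: null_induct)
    case (relation u)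
    then consider
        (l) x x' y where "u = frag_of (x \<oplus>\<^bsub>M\<^esub> x', y) - frag_of (x, y) - frag_of (x', y)"
          "x \<in> carrier M" "x' \<in> carrier M" "y \<in> carrier N"
      | (r) x y y' where "u = frag_of (x, y \<oplus>\<^bsub>N\<^esub> y') - frag_of (x, y) - frag_of (x, y')"
          "x \<in> carrier M" "y \<in> carrier N" "y' \<in> carrier N"
      | (s) c x y where "u = frag_of (c \<odot>\<^bsub>M\<^esub> x, y) - frag_of (x, c \<odot>\<^bsub>N\<^esub> y)"
          "c \<in> carrier K" "x \<in> carrier M" "y \<in> carrier N"
      unfolding tensor_relations_def by blast
    then show ?case
    proof cases
      case l
      then show ?thesis
        using is_linear_add[OF bl, of y x x']
        by (simp add: hdiff h keys_diff_pairs keys_frag_of closed P.minus_eq P.minus_add P.a_ac P.r_neg P.r_neg1)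
    next
      case r
      then show ?thesis
        using is_linear_add[OF br, of x y y']
        by (simp add: hdiff h keys_diff_pairs keys_frag_of closed P.minus_eq P.minus_add P.a_ac P.r_neg P.r_neg1)
    next
      case s
      then show ?thesis
        using is_linear_smult[OF bl, of y c x] is_linear_smult[OF br, of x c y]
        by (simp add: hdiff h keys_frag_of closed P.minus_eq P.r_neg)
    qed
  next
    case (diff u v)
    then show ?case using null_keys by (simp add: hdiff P.minus_eq)
  qed (rule h0)
  \<comment> \<open>The induced map evaluates \<open>h\<close> at any representative; the choice does not matter by \<open>hnull\<close>.\<close>
  define g where "g = (\<lambda>t\<in>carrier (tensor K M N). h (SOME u. Poly_Mapping.keys u \<subseteq> pairs \<and> t = cls u))"
  have g: "g (cls u) = h u" if u: "Poly_Mapping.keys u \<subseteq> pairs" for u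
  proof -
    define v where "v = (SOME v. Poly_Mapping.keys v \<subseteq> pairs \<and> cls u = cls v)"
    have v: "Poly_Mapping.keys v \<subseteq> pairs" "cls u = cls v"
      using someI[of "\<lambda>v. Poly_Mapping.keys v \<subseteq> pairs \<and> cls u = cls v" u] u by (simp_all add: v_def)
    then have "h (u - v) = \<zero>\<^bsub>P\<^esub>" using hnull by (simp add: cls_eq_iff)
    then have "h u \<ominus>\<^bsub>P\<^esub> h v = \<zero>\<^bsub>P\<^esub>" using hdiff u v(1) by simp
    then have "h u = h v" 
      using P.minus_equality[of "h u" "\<ominus>\<^bsub>P\<^esub> h v"] hc[OF u] hc[OF v(1)] by (simp add: P.minus_eq)
    then show ?thesis using u by (simp add: g_def cls_closed v_def)
  qed
  have hscale: "h (scale a u) = a \<odot>\<^bsub>P\<^esub> h u" if a: "a \<in> carrier K" and u: "Poly_Mapping.keys u \<subseteq> pairs" for a u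
    using u
  proof (induction u rule: free_Abelian_group_induct[consumes 1, case_names zero diff single])
    case zero then show ?case using a by (simp add: scale_def h0)
  next
    case (diff u v) then show ?case
      using a by (simp add: scale_diff hdiff keys_scale P.minus_eq P.smult_r_distr P.smult_r_minus hc)
  next
    case (single z) then show ?case
      using a is_linear_smult[OF bl] by (auto simp: scale_def h)
  qed
  show ?thesis
  proof (intro bexI ballI)
    show "g \<in> lin_maps K (tensor K M N) P"
      unfolding lin_maps_iff
    proof
      show "g \<in> extensional (carrier (tensor K M N))" by (simp add: g_def)
      show "is_linear K (tensor K M N) P g"
        by (rule is_linearI)
          (auto elim!: tensorE simp: add_tensor smult_tensor g hc hadd hscale keys_add_pairs keys_scale)
    qed
    show "g (pure_tensor K M N x y) = b x y" if "x \<in> carrier M" "y \<in> carrier N" for x y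
      using that by (simp add: pure_tensor_cls g h keys_frag_of)
  qed
qed

text \<open>The description defining \<open>tensor_lift\<close> has exactly one solution, by the two lemmas above.\<close>

lemma
  assumes P: "module K P" and b: "is_bilinear K M N P b"
  shows tensor_lift_lin_map: "tensor_lift K M N P b \<in> lin_maps K (tensor K M N) P" (is ?lin)
    and tensor_lift_pure: "x \<in> carrier M \<Longrightarrow> y \<in> carrier N \<Longrightarrow>
      tensor_lift K M N P b (pure_tensor K M N x y) = b x y"
proof -
  let ?Q = "\<lambda>h. h \<in> lin_maps K (tensor K M N) P \<and>
       (\<forall>x\<in>carrier M. \<forall>y\<in>carrier N. h (pure_tensor K M N x y) = b x y)"
  from bilinear_extends[OF P b] obtain h where h: "?Q h" by blast
  have *: "?Q (tensor_lift K M N P b)"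
    unfolding tensor_lift_def
  proof (rule theI[of ?Q h])
    show "?Q h" using h by simp
    fix h' assume h': "?Q h'"
    have "h' t = h t" if t: "t \<in> carrier (tensor K M N)" for t
      by (rule linear_on_tensor_eqI[OF P _ _ _ t]) (use h h' in \<open>simp_all add: lin_maps_iff\<close>)
    moreover have "h' \<in> extensional (carrier (tensor K M N))" "h \<in> extensional (carrier (tensor K M N))"
      using h h' by (simp_all add: lin_maps_iff)
    ultimately show "h' = h" by (rule extensionalityI[rotated 2])
  qed
  show ?lin using * by blast
  show "tensor_lift K M N P b (pure_tensor K M N x y) = b x y" if "x \<in> carrier M" "y \<in> carrier N"
    using * that by blast
qed

lemma tensor_lift_linear:
  assumes "module K P" "is_bilinear K M N P b"
  shows "is_linear K (tensor K M N) P (tensor_lift K M N P b)"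
  using tensor_lift_lin_map[OF assms] by (simp add: lin_maps_iff)

lemma tensor_lift_unique:
  assumes "module K P" "is_bilinear K M N P b" "is_linear K (tensor K M N) P f"
    and "\<And>x y. x \<in> carrier M \<Longrightarrow> y \<in> carrier N \<Longrightarrow> f (pure_tensor K M N x y) = b x y"
    and "t \<in> carrier (tensor K M N)"
  shows "f t = tensor_lift K M N P b t"
  by (rule linear_on_tensor_eqI[OF assms(1,3) tensor_lift_linear[OF assms(1,2)] _ assms(5)])
    (simp add: assms(4) tensor_lift_pure[OF assms(1,2)])

end

section \<open>Calculating with tensor lifts\<close>

lemma tensor_lift_cong:
  assumes "\<And>x y. x \<in> carrier M \<Longrightarrow> y \<in> carrier N \<Longrightarrow> b x y = b' x y"
  shows "tensor_lift K M N P b = tensor_lift K M N P b'"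
  unfolding tensor_lift_def using assms by simp

lemma tensor_map_cong:
  assumes "\<And>x. x \<in> carrier M \<Longrightarrow> f x = f' x" "\<And>y. y \<in> carrier N \<Longrightarrow> g y = g' y"
  shows "tensor_map K M N P Q f g = tensor_map K M N P Q f' g'"
  unfolding tensor_map_def using assms by (intro tensor_lift_cong) simp

context tensor_product
begin

lemma linear_tensor_lift:
  assumes "module K P" "module K Q" "is_bilinear K M N P b" "is_linear K P Q f"
    and "t \<in> carrier (tensor K M N)"
  shows "f (tensor_lift K M N P b t) = tensor_lift K M N Q (\<lambda>x y. f (b x y)) t"
  by (rule tensor_lift_unique[OF assms(2) is_bilinear_comp[OF assms(3,4)] _ _ assms(5)])
    (use is_linear_comp[OF tensor_lift_linear[OF assms(1,3)] assms(4)] tensor_lift_pure[OF assms(1,3)] in auto)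

text \<open>A family of bilinear maps that depends linearly on a parameter has lifts that depend linearly
  on it. The associator is a lift of lifts, and the outer lift needs this.\<close>

lemma tensor_lift_parameter_linear:
  assumes P: "module K P" and Q: "module K Q"
    and b: "\<And>p. p \<in> carrier P \<Longrightarrow> is_bilinear K M N Q (b p)"
    and lin: "\<And>x y. x \<in> carrier M \<Longrightarrow> y \<in> carrier N \<Longrightarrow> is_linear K P Q (\<lambda>p. b p x y)"
    and t: "t \<in> carrier (tensor K M N)"
  shows "is_linear K P Q (\<lambda>p. tensor_lift K M N Q (b p) t)"
  using t
proof (induction t rule: tensor_induct)
  case (pure x y)
  then show ?case
    by (subst is_linear_cong[OF P, where g = "\<lambda>p. b p x y"]) (simp_all add: tensor_lift_pure[OF Q b] lin)
next
  case (minus t s)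
  interpret T: module K "tensor K M N" by (rule tensor_module)
  have "tensor_lift K M N Q (b p) (t \<oplus>\<^bsub>tensor K M N\<^esub> \<ominus>\<^bsub>tensor K M N\<^esub> s)
      = tensor_lift K M N Q (b p) t \<oplus>\<^bsub>Q\<^esub> \<ominus>\<^bsub>Q\<^esub> tensor_lift K M N Q (b p) s" if "p \<in> carrier P" for p
    using is_linear_add[OF tensor_lift_linear[OF Q b[OF that]], of t "\<ominus>\<^bsub>tensor K M N\<^esub> s"] minus(1,2)
      is_linear_uminus[OF tensor_module Q tensor_lift_linear[OF Q b[OF that]], of s] by simp
  then show ?case
    using is_linear_pointwise_add[OF P Q minus.IH(1) is_linear_pointwise_uminus[OF P Q minus.IH(2)]]
    by (subst is_linear_cong[OF P]) auto
qed

lemma tensor_lift_tensor_map: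
  assumes P: "module K P" and Q: "module K Q" and f: "is_linear K M P f" and g: "is_linear K N Q g"
    and R: "module K R" and b: "is_bilinear K P Q R b" and t: "t \<in> carrier (tensor K M N)"
  shows "tensor_lift K P Q R b (tensor_map K M N P Q f g t) = tensor_lift K M N R (\<lambda>x y. b (f x) (g y)) t"
proof -
  interpret PQ: tensor_product K P Q using P Q by (rule tensor_product.intro)
  note fg = is_bilinear_comp_args[OF PQ.pure_tensor_bilinear f g]
  have "tensor_lift K M N R (\<lambda>x y. tensor_lift K P Q R b (pure_tensor K P Q (f x) (g y)))
      = tensor_lift K M N R (\<lambda>x y. b (f x) (g y))"
    by (rule tensor_lift_cong)
      (simp add: PQ.tensor_lift_pure[OF R b] is_linear_closed[OF f] is_linear_closed[OF g])
  then show ?thesis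
    unfolding tensor_map_def
    using linear_tensor_lift[OF PQ.tensor_module R fg PQ.tensor_lift_linear[OF R b] t] by simp
qed

lemma tensor_map_id:
  assumes "t \<in> carrier (tensor K M N)"
  shows "tensor_map K M N M N (\<lambda>x. x) (\<lambda>y. y) t = t"
  unfolding tensor_map_def
  by (rule tensor_lift_unique[OF tensor_module _ is_linear_id _ assms, symmetric])
    (simp_all add: pure_tensor_bilinear)

end

section \<open>Linear functionals separate points\<close>

text \<open>Instead of a basis, choose a subspace \<open>W\<close> maximal among those that miss \<open>x\<close>. Every \<open>y\<close> lies in
  \<open>W + K x\<close>: if \<open>y \<notin> W\<close>, then \<open>W + K y\<close> contains \<open>x = w + b y\<close> by maximality, where \<open>b \<noteq> 0\<close>
  can be inverted. The sum is direct because \<open>x \<notin> W\<close>, and the functional is the coordinate along \<open>x\<close>.\<close>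

lemma exists_functional_nonzero:
  assumes K: "field K" and M: "module K M" and x: "x \<in> carrier M" "x \<noteq> \<zero>\<^bsub>M\<^esub>"
  shows "\<exists>c\<in>lin_maps K M (base_module K). c x \<noteq> \<zero>\<^bsub>K\<^esub>"
proof -
  interpret K: field K by fact
  interpret M: module K M by fact
  define subsp where "subsp W \<longleftrightarrow> W \<subseteq> carrier M \<and> \<zero>\<^bsub>M\<^esub> \<in> W \<and>
    (\<forall>u\<in>W. \<forall>v\<in>W. u \<oplus>\<^bsub>M\<^esub> v \<in> W) \<and> (\<forall>a\<in>carrier K. \<forall>u\<in>W. a \<odot>\<^bsub>M\<^esub> u \<in> W)" for W
  define A where "A = {W. subsp W \<and> x \<notin> W}"
  have "\<exists>W\<in>A. \<forall>X\<in>A. W \<subseteq> X \<longrightarrow> X = W"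
  proof (rule subset_Zorn_nonempty)
    have "{\<zero>\<^bsub>M\<^esub>} \<in> A" using x by (simp add: A_def subsp_def)
    then show "A \<noteq> {}" by blast
    show "\<Union>\<C> \<in> A" if "\<C> \<noteq> {}" "subset.chain A \<C>" for \<C>
    proof -
      have sub: "subsp W" "x \<notin> W" if "W \<in> \<C>" for W
        using that \<open>subset.chain A \<C>\<close> by (auto simp: subset.chain_def A_def)
      have lin: "W \<subseteq> W' \<or> W' \<subseteq> W" if "W \<in> \<C>" "W' \<in> \<C>" for W W'
        using that \<open>subset.chain A \<C>\<close> by (auto simp: subset.chain_def)
      have "u \<oplus>\<^bsub>M\<^esub> v \<in> \<Union>\<C>" if uv: "u \<in> \<Union>\<C>" "v \<in> \<Union>\<C>" for u v
      proof -
        obtain W W' where W: "W \<in> \<C>" "W' \<in> \<C>" "u \<in> W" "v \<in> W'" using uv by blast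
        then obtain W'' where "W'' \<in> \<C>" "u \<in> W''" "v \<in> W''" using lin[of W W'] by blast
        then show ?thesis using sub[of W''] unfolding subsp_def by blast
      qed
      then have "subsp (\<Union>\<C>)"
        using sub \<open>\<C> \<noteq> {}\<close> unfolding subsp_def by blast
      then show ?thesis using sub by (auto simp: A_def)
    qed
  qed
  then obtain W where W: "subsp W" "x \<notin> W" and max: "\<And>X. subsp X \<Longrightarrow> x \<notin> X \<Longrightarrow> W \<subseteq> X \<Longrightarrow> X = W"
    unfolding A_def by blast
  have Wc: "u \<in> carrier M" if "u \<in> W" for u using W(1) that unfolding subsp_def by blast
  have W0: "\<zero>\<^bsub>M\<^esub> \<in> W" using W(1) unfolding subsp_def by blast
  have Wadd: "u \<oplus>\<^bsub>M\<^esub> v \<in> W" if "u \<in> W" "v \<in> W" for u v using W(1) that unfolding subsp_def by blast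
  have Wsm: "a \<odot>\<^bsub>M\<^esub> u \<in> W" if "a \<in> carrier K" "u \<in> W" for a u using W(1) that unfolding subsp_def by blast
  have Wneg: "\<ominus>\<^bsub>M\<^esub> u \<in> W" if "u \<in> W" for u
    using Wsm[of "\<ominus>\<^bsub>K\<^esub> \<one>\<^bsub>K\<^esub>" u] that Wc[OF that] by (simp add: M.smult_l_minus)
  \<comment> \<open>The graph of the coordinate along \<open>x\<close>.\<close>
  define R where "R y a \<longleftrightarrow> a \<in> carrier K \<and> (\<exists>w\<in>W. y = w \<oplus>\<^bsub>M\<^esub> a \<odot>\<^bsub>M\<^esub> x)" for y a
  have ex: "\<exists>a. R y a" if y: "y \<in> carrier M" for y
  proof (cases "y \<in> W")
    case True
    then show ?thesis
      unfolding R_def using y x by (intro exI[of _ "\<zero>\<^bsub>K\<^esub>"]) (auto intro!: bexI[of _ y])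
  next
    case False
    \<comment> \<open>The subspace \<open>W + K y\<close>, strictly larger than \<open>W\<close>, must contain \<open>x\<close>.\<close>
    define X where "X = {w \<oplus>\<^bsub>M\<^esub> b \<odot>\<^bsub>M\<^esub> y |w b. w \<in> W \<and> b \<in> carrier K}"
    have XI: "w \<oplus>\<^bsub>M\<^esub> b \<odot>\<^bsub>M\<^esub> y \<in> X" if "w \<in> W" "b \<in> carrier K" for w b
      using that unfolding X_def by blast
    have "subsp X"
      unfolding subsp_def
    proof (intro conjI ballI)
      show "X \<subseteq> carrier M" using Wc y by (auto simp: X_def)
      show "\<zero>\<^bsub>M\<^esub> \<in> X" using XI[OF W0, of "\<zero>\<^bsub>K\<^esub>"] y by simp
      show "u \<oplus>\<^bsub>M\<^esub> v \<in> X" if uv: "u \<in> X" "v \<in> X" for u v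
      proof -
        obtain w b w' b' where *: "u = w \<oplus>\<^bsub>M\<^esub> b \<odot>\<^bsub>M\<^esub> y" "v = w' \<oplus>\<^bsub>M\<^esub> b' \<odot>\<^bsub>M\<^esub> y"
          "w \<in> W" "b \<in> carrier K" "w' \<in> W" "b' \<in> carrier K" using uv unfolding X_def by blast
        have "u \<oplus>\<^bsub>M\<^esub> v = (w \<oplus>\<^bsub>M\<^esub> w') \<oplus>\<^bsub>M\<^esub> (b \<oplus>\<^bsub>K\<^esub> b') \<odot>\<^bsub>M\<^esub> y"
          using * Wc y by (simp add: M.smult_l_distr M.M.a_ac)
        then show ?thesis using XI[OF Wadd[OF *(3,5)], of "b \<oplus>\<^bsub>K\<^esub> b'"] * by simp
      qed
      show "a \<odot>\<^bsub>M\<^esub> u \<in> X" if a: "a \<in> carrier K" and u: "u \<in> X" for a u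
      proof -
        obtain w b where *: "u = w \<oplus>\<^bsub>M\<^esub> b \<odot>\<^bsub>M\<^esub> y" "w \<in> W" "b \<in> carrier K"
          using u unfolding X_def by blast
        have "a \<odot>\<^bsub>M\<^esub> u = a \<odot>\<^bsub>M\<^esub> w \<oplus>\<^bsub>M\<^esub> (a \<otimes>\<^bsub>K\<^esub> b) \<odot>\<^bsub>M\<^esub> y"
          using * a Wc y by (simp add: M.smult_r_distr M.smult_assoc1)
        then show ?thesis using XI[OF Wsm[OF a *(2)], of "a \<otimes>\<^bsub>K\<^esub> b"] * a by simp
      qed
    qed
    moreover have "W \<subseteq> X"
    proof
      fix w assume "w \<in> W"
      then show "w \<in> X" using XI[of w "\<zero>\<^bsub>K\<^esub>"] Wc y by simp
    qed
    moreover have "y \<in> X" using XI[OF W0, of "\<one>\<^bsub>K\<^esub>"] y by simp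
    ultimately have "x \<in> X" using max False by blast
    then obtain w b where wb: "x = w \<oplus>\<^bsub>M\<^esub> b \<odot>\<^bsub>M\<^esub> y" "w \<in> W" "b \<in> carrier K"
      unfolding X_def by blast
    have b0: "b \<noteq> \<zero>\<^bsub>K\<^esub>" using wb W(2) Wc y by auto
    define i where "i = inv\<^bsub>K\<^esub> b"
    have i: "i \<in> carrier K" "i \<otimes>\<^bsub>K\<^esub> b = \<one>\<^bsub>K\<^esub>"
      using b0 wb(3) K.field_Units by (simp_all add: i_def)
    have "i \<odot>\<^bsub>M\<^esub> x = i \<odot>\<^bsub>M\<^esub> w \<oplus>\<^bsub>M\<^esub> (i \<otimes>\<^bsub>K\<^esub> b) \<odot>\<^bsub>M\<^esub> y"
      using wb i(1) Wc y by (simp add: M.smult_r_distr M.smult_assoc1)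
    then have "i \<odot>\<^bsub>M\<^esub> x = i \<odot>\<^bsub>M\<^esub> w \<oplus>\<^bsub>M\<^esub> y" using i y by simp
    then have "y = \<ominus>\<^bsub>M\<^esub> (i \<odot>\<^bsub>M\<^esub> w) \<oplus>\<^bsub>M\<^esub> i \<odot>\<^bsub>M\<^esub> x"
      using i(1) Wc[OF wb(2)] y by (simp add: M.M.r_neg2 M.M.r_neg1)
    then show ?thesis
      unfolding R_def using i(1) Wneg[OF Wsm[OF i(1) wb(2)]] by blast
  qed
  have R_add: "R (y \<oplus>\<^bsub>M\<^esub> z) (a \<oplus>\<^bsub>K\<^esub> b)" if yz: "R y a" "R z b" for y z a b
  proof -
    obtain w w' where *: "y = w \<oplus>\<^bsub>M\<^esub> a \<odot>\<^bsub>M\<^esub> x" "z = w' \<oplus>\<^bsub>M\<^esub> b \<odot>\<^bsub>M\<^esub> x" "w \<in> W" "w' \<in> W"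
      and ab: "a \<in> carrier K" "b \<in> carrier K" using yz unfolding R_def by blast
    have "y \<oplus>\<^bsub>M\<^esub> z = (w \<oplus>\<^bsub>M\<^esub> w') \<oplus>\<^bsub>M\<^esub> (a \<oplus>\<^bsub>K\<^esub> b) \<odot>\<^bsub>M\<^esub> x"
      using * ab Wc x by (simp add: M.smult_l_distr M.M.a_ac)
    then show ?thesis using Wadd[OF *(3,4)] ab unfolding R_def by blast
  qed
  have R_smult: "R (b \<odot>\<^bsub>M\<^esub> y) (b \<otimes>\<^bsub>K\<^esub> a)" if b: "b \<in> carrier K" and y: "R y a" for y a b
  proof -
    obtain w where *: "y = w \<oplus>\<^bsub>M\<^esub> a \<odot>\<^bsub>M\<^esub> x" "w \<in> W" and a: "a \<in> carrier K" using y unfolding R_def by blast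
    have "b \<odot>\<^bsub>M\<^esub> y = b \<odot>\<^bsub>M\<^esub> w \<oplus>\<^bsub>M\<^esub> (b \<otimes>\<^bsub>K\<^esub> a) \<odot>\<^bsub>M\<^esub> x"
      using * a b Wc x by (simp add: M.smult_r_distr M.smult_assoc1)
    then show ?thesis using Wsm[OF b *(2)] a b unfolding R_def by blast
  qed
  have R_zero: "a = \<zero>\<^bsub>K\<^esub>" if za: "R \<zero>\<^bsub>M\<^esub> a" for a
  proof (rule ccontr)
    assume "a \<noteq> \<zero>\<^bsub>K\<^esub>"
    obtain w where *: "\<zero>\<^bsub>M\<^esub> = w \<oplus>\<^bsub>M\<^esub> a \<odot>\<^bsub>M\<^esub> x" "w \<in> W" and a: "a \<in> carrier K"
      using za unfolding R_def by blast
    have "a \<odot>\<^bsub>M\<^esub> x = \<ominus>\<^bsub>M\<^esub> w"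
      using M.M.minus_equality[of "a \<odot>\<^bsub>M\<^esub> x" w] * a x Wc by (simp add: M.M.a_comm)
    then have "a \<odot>\<^bsub>M\<^esub> x \<in> W" using Wneg[OF *(2)] by simp
    then have "inv\<^bsub>K\<^esub> a \<odot>\<^bsub>M\<^esub> (a \<odot>\<^bsub>M\<^esub> x) \<in> W"
      using Wsm a \<open>a \<noteq> \<zero>\<^bsub>K\<^esub>\<close> K.field_Units by simp
    then have "x \<in> W"
      using a \<open>a \<noteq> \<zero>\<^bsub>K\<^esub>\<close> K.field_Units x by (simp flip: M.smult_assoc1)
    then show False using W(2) by simp
  qed
  have R_unique: "a = b" if ab: "R y a" "R y b" and y: "y \<in> carrier M" for y a b
  proof -
    have c: "a \<in> carrier K" "b \<in> carrier K" using ab unfolding R_def by blast+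
    have "R (y \<oplus>\<^bsub>M\<^esub> (\<ominus>\<^bsub>K\<^esub> \<one>\<^bsub>K\<^esub>) \<odot>\<^bsub>M\<^esub> y) (a \<oplus>\<^bsub>K\<^esub> (\<ominus>\<^bsub>K\<^esub> \<one>\<^bsub>K\<^esub>) \<otimes>\<^bsub>K\<^esub> b)"
      by (rule R_add[OF ab(1) R_smult[OF _ ab(2)]]) simp
    then have "R \<zero>\<^bsub>M\<^esub> (a \<oplus>\<^bsub>K\<^esub> \<ominus>\<^bsub>K\<^esub> b)"
      using y c by (simp add: M.smult_l_minus M.M.r_neg K.l_minus)
    then have "a \<oplus>\<^bsub>K\<^esub> \<ominus>\<^bsub>K\<^esub> b = \<zero>\<^bsub>K\<^esub>" by (rule R_zero)
    then show ?thesis using K.minus_equality[of a "\<ominus>\<^bsub>K\<^esub> b"] c by simp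
  qed
  define c where "c = (\<lambda>y\<in>carrier M. THE a. R y a)"
  have c: "c y = a" if "R y a" "y \<in> carrier M" for y a
    using that R_unique by (auto simp: c_def)
  have cR: "R y (c y)" if "y \<in> carrier M" for y
    using ex[OF that] c[OF _ that] by auto
  have "c \<in> lin_maps K M (base_module K)"
    unfolding lin_maps_iff
  proof
    show "is_linear K M (base_module K) c"
    proof (rule is_linearI)
      show "c y \<in> carrier (base_module K)" if "y \<in> carrier M" for y
        using cR[OF that] by (simp add: R_def)
    qed (auto intro!: c R_add R_smult cR)
  qed (simp add: c_def)
  moreover have "c x = \<one>\<^bsub>K\<^esub>"
    by (rule c) (use x W0 in \<open>auto simp: R_def intro!: bexI[of _ "\<zero>\<^bsub>M\<^esub>"]\<close>)
  ultimately show ?thesis by (intro bexI[of _ c]) simp_all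
qed

lemma functionals_separate:
  assumes K: "field K" and M: "module K M" and x: "x \<in> carrier M" and y: "y \<in> carrier M"
    and eq: "\<And>c. c \<in> lin_maps K M (base_module K) \<Longrightarrow> c x = c y"
  shows "x = y"
proof (rule ccontr)
  interpret K: field K by fact
  interpret M: module K M by fact
  have Kb: "module K (base_module K)" by (rule base_module_module) (rule K.is_cring)
  interpret B: module K "base_module K" by (rule Kb)
  assume "x \<noteq> y"
  then have "x \<oplus>\<^bsub>M\<^esub> \<ominus>\<^bsub>M\<^esub> y \<noteq> \<zero>\<^bsub>M\<^esub>"
    using M.M.minus_equality[of x "\<ominus>\<^bsub>M\<^esub> y"] x y by auto
  then obtain c where c: "c \<in> lin_maps K M (base_module K)" "c (x \<oplus>\<^bsub>M\<^esub> \<ominus>\<^bsub>M\<^esub> y) \<noteq> \<zero>\<^bsub>K\<^esub>"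
    using exists_functional_nonzero[OF K M, of "x \<oplus>\<^bsub>M\<^esub> \<ominus>\<^bsub>M\<^esub> y"] x y by auto
  then have lin: "is_linear K M (base_module K) c" by (simp add: lin_maps_iff)
  have "c (x \<oplus>\<^bsub>M\<^esub> \<ominus>\<^bsub>M\<^esub> y) = c x \<oplus>\<^bsub>base_module K\<^esub> \<ominus>\<^bsub>base_module K\<^esub> c y"
    using is_linear_add[OF lin x, of "\<ominus>\<^bsub>M\<^esub> y"] is_linear_uminus[OF M Kb lin y] y by simp
  also have "\<dots> = \<zero>\<^bsub>base_module K\<^esub>"
    using eq[OF c(1)] is_linear_closed[OF lin y] by (simp only: B.M.r_neg)
  finally show False using c(2) by simp
qed

section \<open>The regular comodule\<close>

text \<open>The regular comodule has the vector space of \<open>C\<close> in a different record type, so every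
  construction on it agrees with the one on \<open>C\<close>. The rewrite rules below make facts about
  comodules apply to \<open>C\<close> itself.\<close>

lemma regular_comodule_simps [simp]:
  "carrier (regular_comodule C) = carrier C"
  "\<zero>\<^bsub>regular_comodule C\<^esub> = \<zero>\<^bsub>C\<^esub>"
  "x \<oplus>\<^bsub>regular_comodule C\<^esub> y = x \<oplus>\<^bsub>C\<^esub> y"
  "a \<odot>\<^bsub>regular_comodule C\<^esub> x = a \<odot>\<^bsub>C\<^esub> x"
  "coact (regular_comodule C) = comult C"
  by (simp_all add: regular_comodule_def)

lemma is_linear_regular_comodule [simp]:
  "is_linear K (regular_comodule C) N f \<longleftrightarrow> is_linear K C N f"
  "is_linear K M (regular_comodule C) g \<longleftrightarrow> is_linear K M C g"
  by (simp_all add: is_linear_def)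

lemma lin_maps_regular_comodule [simp]:
  "lin_maps K (regular_comodule C) N = lin_maps K C N"
  "lin_maps K M (regular_comodule C) = lin_maps K M C"
  by (simp_all add: lin_maps_def)

lemma tensor_regular_comodule [simp]:
  "tensor K (regular_comodule C) N = tensor K C N"
  "pure_tensor K (regular_comodule C) N = pure_tensor K C N"
  by (simp_all add: tensor_def pure_tensor_def tensor_free_def tensor_null_def tensor_relations_def fun_eq_iff)

lemma tensor_lift_regular_comodule [simp]:
  "tensor_lift K (regular_comodule C) N P = tensor_lift K C N P"
  "tensor_lift K M N (regular_comodule C) = tensor_lift K M N C"
  by (simp_all add: tensor_lift_def fun_eq_iff)

lemma tensor_map_regular_comodule [simp]:
  "tensor_map K (regular_comodule C) N P Q = tensor_map K C N P Q"
  "tensor_map K M N (regular_comodule C) Q = tensor_map K M N C Q"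
  by (simp_all add: tensor_map_def fun_eq_iff)

lemma tensor_assoc_regular_comodule [simp]:
  "tensor_assoc K (regular_comodule C) N P = tensor_assoc K C N P"
  by (simp add: tensor_assoc_def fun_eq_iff)

lemma module_regular_comodule:
  assumes "module K C" shows "module K (regular_comodule C)"
proof -
  interpret module K C by fact
  have "abelian_group (regular_comodule C)"
    by (rule abelian_groupI) (auto simp: M.a_ac intro: bexI[of _ "\<ominus>\<^bsub>C\<^esub> _"] M.l_neg)
  then show ?thesis
    by (intro moduleI is_cring) (auto simp: smult_l_distr smult_r_distr smult_assoc1)
qed

lemma (in coalgebra) regular_comodule: "comodule K C (regular_comodule C)"
proof (rule comodule.intro)
  show "coalgebra K C" by (rule coalgebra_axioms)
  show "module K (regular_comodule C)" by (rule module_regular_comodule[OF vector_space])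
qed (simp_all add: comult_linear coassoc counit_right)

section \<open>Matrix coefficients and the actions of the dual algebra\<close>

text \<open>In Sweedler notation \<open>\<Sum> g(m\<^sub>0) m\<^sub>1\<close>. For fixed \<open>m\<close> and varying \<open>g\<close> these are the matrix
  coefficients of the comodule; for the regular comodule they give the right action \<open>m \<cdot> g\<close>.\<close>

definition coefficient ::
  "('k, 'z) ring_scheme \<Rightarrow> ('k, 'c) coalgebra \<Rightarrow> ('k, 'm, 'c) comodule \<Rightarrow> ('m \<Rightarrow> 'k) \<Rightarrow> 'm \<Rightarrow> 'c"
  where "coefficient K C M g m = tensor_lift K M C C (\<lambda>m0 m1. g m0 \<odot>\<^bsub>C\<^esub> m1) (coact M m)"

lemma dual_right_act_eq_coefficient:
  "dual_right_act K C x c = coefficient K C (regular_comodule C) c x"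
  by (simp add: dual_right_act_def coefficient_def)

context coalgebra
begin

abbreviation base where "base \<equiv> base_module K"

lemma cring_base: "cring K"
proof -
  interpret module K C by (rule vector_space)
  show ?thesis by (rule is_cring)
qed

lemma scalar_commute: "a \<in> carrier K \<Longrightarrow> b \<in> carrier K \<Longrightarrow> a \<otimes>\<^bsub>K\<^esub> b = b \<otimes>\<^bsub>K\<^esub> a"
  by (rule comm_monoid.m_comm[OF cring.axioms(2)[OF cring_base]])

lemma base_vector_space: "module K base"
  by (rule base_module_module[OF cring_base])

lemma dual_carrier: "carrier (dual_algebra K C) = lin_maps K C base"
  and dual_zero: "\<zero>\<^bsub>dual_algebra K C\<^esub> = (\<lambda>x\<in>carrier C. \<zero>\<^bsub>K\<^esub>)"
  and dual_one: "\<one>\<^bsub>dual_algebra K C\<^esub> = counit C"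
  and dual_add: "c \<oplus>\<^bsub>dual_algebra K C\<^esub> d = (\<lambda>x\<in>carrier C. c x \<oplus>\<^bsub>K\<^esub> d x)"
  by (simp_all add: dual_algebra_def)

lemma dual_linear: "c \<in> carrier (dual_algebra K C) \<Longrightarrow> is_linear K C base c"
  by (simp add: dual_carrier lin_maps_iff)

lemma dual_eqI:
  assumes "c \<in> carrier (dual_algebra K C)" "d \<in> carrier (dual_algebra K C)"
    and "\<And>x. x \<in> carrier C \<Longrightarrow> c x = d x"
  shows "c = d"
  using assms by (intro extensionalityI[of _ "carrier C"]) (auto simp: dual_carrier lin_maps_iff)

lemma dual_add_closed:
  assumes "c \<in> carrier (dual_algebra K C)" "d \<in> carrier (dual_algebra K C)"
  shows "c \<oplus>\<^bsub>dual_algebra K C\<^esub> d \<in> carrier (dual_algebra K C)"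
  using is_linear_pointwise_add[OF vector_space base_vector_space dual_linear[OF assms(1)] dual_linear[OF assms(2)]]
  by (simp add: dual_carrier dual_add lin_maps_iff is_linear_cong[OF vector_space, of "restrict _ (carrier C)"])

end

context comodule
begin

sublocale C: coalgebra K C by (rule coalgebra)

abbreviation base where "base \<equiv> base_module K"
abbreviation act where "act \<equiv> dual_left_act K C M"

sublocale MC: tensor_product K M C
  using vector_space C.vector_space by (rule tensor_product.intro)

sublocale CC: tensor_product K C C
  using C.vector_space by (intro tensor_product.intro)

lemma coact_is_linear: "is_linear K M (tensor K M C) (coact M)"
  using coact_linear by (simp add: lin_maps_iff)

lemma coact_closed: "m \<in> carrier M \<Longrightarrow> coact M m \<in> carrier (tensor K M C)"
  using is_linear_closed[OF coact_is_linear] .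

lemma act_linear:
  assumes "is_linear K C base c"
  shows "is_linear K M M (act c)"
  unfolding dual_left_act_def
  by (rule is_linear_comp[OF coact_is_linear])
    (rule MC.tensor_lift_linear[OF vector_space
      is_bilinear_functional_right[OF vector_space C.vector_space assms]])

lemma coefficient_linear:
  assumes "is_linear K M base g"
  shows "is_linear K M C (coefficient K C M g)"
  unfolding coefficient_def
  by (rule is_linear_comp[OF coact_is_linear])
    (rule MC.tensor_lift_linear[OF C.vector_space
      is_bilinear_functional_left[OF vector_space C.vector_space assms]])

lemma linear_apply_act:
  assumes "module K P" "is_linear K M P f" "is_linear K C base c" "m \<in> carrier M"
  shows "f (act c m) = tensor_lift K M C P (\<lambda>m0 m1. c m1 \<odot>\<^bsub>P\<^esub> f m0) (coact M m)"
proof -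
  have "tensor_lift K M C P (\<lambda>m0 m1. f (c m1 \<odot>\<^bsub>M\<^esub> m0)) = tensor_lift K M C P (\<lambda>m0 m1. c m1 \<odot>\<^bsub>P\<^esub> f m0)"
    using is_linear_closed[OF assms(3)] by (intro tensor_lift_cong) (simp add: is_linear_smult[OF assms(2)])
  then show ?thesis
    unfolding dual_left_act_def
    using MC.linear_tensor_lift[OF vector_space assms(1)
        is_bilinear_functional_right[OF vector_space C.vector_space assms(3)] assms(2) coact_closed[OF assms(4)]]
    by simp
qed

text \<open>Both sides are \<open>\<Sum> c(m\<^sub>1) g(m\<^sub>0)\<close>. As functionals separate the points of \<open>C\<close>, this identity
  determines \<open>coefficient K C M g m\<close> completely, and everything below about matrix coefficients is
  derived from it.\<close>

lemma functional_coefficient: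
  assumes c: "is_linear K C base c" and g: "is_linear K M base g" and m: "m \<in> carrier M"
  shows "c (coefficient K C M g m) = g (act c m)"
proof -
  have "c (g x \<odot>\<^bsub>C\<^esub> y) = c y \<otimes>\<^bsub>K\<^esub> g x" if "x \<in> carrier M" "y \<in> carrier C" for x y
    using that is_linear_smult[OF c] is_linear_closed[OF c] is_linear_closed[OF g]
    by (simp add: C.scalar_commute)
  then have "tensor_lift K M C base (\<lambda>x y. c (g x \<odot>\<^bsub>C\<^esub> y)) = tensor_lift K M C base (\<lambda>x y. c y \<otimes>\<^bsub>K\<^esub> g x)"
    by (rule tensor_lift_cong)
  then show ?thesis
    using linear_apply_act[OF C.base_vector_space g c m]
      MC.linear_tensor_lift[OF C.vector_space C.base_vector_space
        is_bilinear_functional_left[OF vector_space C.vector_space g] c coact_closed[OF m]]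
    by (simp add: coefficient_def)
qed

lemma act_closed: "c \<in> carrier (dual_algebra K C) \<Longrightarrow> m \<in> carrier M \<Longrightarrow> act c m \<in> carrier M"
  using is_linear_closed[OF act_linear[OF C.dual_linear]] .

lemma coefficient_closed:
  "g \<in> lin_maps K M base \<Longrightarrow> m \<in> carrier M \<Longrightarrow> coefficient K C M g m \<in> carrier C"
  using is_linear_closed[OF coefficient_linear] by (simp add: lin_maps_iff)

lemma act_counit: "m \<in> carrier M \<Longrightarrow> act (counit C) m = m"
  by (simp add: dual_left_act_def coact_counit)

text \<open>Pairing with a functional \<open>g\<close> turns \<open>act c m\<close> into \<open>c (coefficient K C M g m)\<close>, which is
  visibly additive in \<open>c\<close>.\<close>

lemma act_add:
  assumes c: "c \<in> carrier (dual_algebra K C)" and d: "d \<in> carrier (dual_algebra K C)" and m: "m \<in> carrier M"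
  shows "act (c \<oplus>\<^bsub>dual_algebra K C\<^esub> d) m = act c m \<oplus>\<^bsub>M\<^esub> act d m"
proof (rule functionals_separate[OF C.base_field vector_space])
  note cd = C.dual_add_closed[OF c d]
  show "act (c \<oplus>\<^bsub>dual_algebra K C\<^esub> d) m \<in> carrier M" using act_closed[OF cd m] .
  show "act c m \<oplus>\<^bsub>M\<^esub> act d m \<in> carrier M" using act_closed c d m by simp
  fix g assume "g \<in> lin_maps K M base"
  then have g: "is_linear K M base g" by (simp add: lin_maps_iff)
  have "coefficient K C M g m \<in> carrier C" using is_linear_closed[OF coefficient_linear[OF g] m] .
  then show "g (act (c \<oplus>\<^bsub>dual_algebra K C\<^esub> d) m) = g (act c m \<oplus>\<^bsub>M\<^esub> act d m)"
    using functional_coefficient[OF _ g m] C.dual_linear[OF c] C.dual_linear[OF d] C.dual_linear[OF cd]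
      is_linear_add[OF g act_closed[OF c m] act_closed[OF d m]]
    by (simp flip: functional_coefficient[OF _ g m] add: C.dual_add)
qed

text \<open>The only use of coassociativity. Apply the linear map
  \<open>phi (x \<otimes> (y \<otimes> z)) = c(y) d(z) x\<close> to both sides of the coassociativity axiom for \<open>m\<close>: the side
  containing \<open>coact M m\<^sub>0\<close> becomes \<open>\<Sum> d(m\<^sub>1) (c \<cdot> m\<^sub>0) = c \<cdot> (d \<cdot> m)\<close>, the side containing
  \<open>comult C m\<^sub>1\<close> becomes the action of the convolution product.\<close>

lemma act_iterated:
  assumes c: "is_linear K C base c" and d: "is_linear K C base d" and m: "m \<in> carrier M"
  shows "act c (act d m) = act (\<lambda>x. tensor_lift K C C base (\<lambda>x1 x2. c x1 \<otimes>\<^bsub>K\<^esub> d x2) (comult C x)) m"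
proof -
  let ?T = "tensor K C C"
  let ?MT = "tensor K M ?T"
  have T: "module K ?T" by (rule CC.tensor_module)
  have MCm: "module K (tensor K M C)" by (rule MC.tensor_module)
  interpret MT: tensor_product K M ?T using vector_space T by (rule tensor_product.intro)
  interpret MCC: tensor_product K "tensor K M C" C using MCm C.vector_space by (rule tensor_product.intro)
  have comult: "is_linear K C ?T (comult C)" using C.comult_linear by (simp add: lin_maps_iff)
  note idC = is_linear_restrict_id[OF C.vector_space]
  note idM = is_linear_restrict_id[OF vector_space]
  have bcd: "is_bilinear K C C base (\<lambda>y z. c y \<otimes>\<^bsub>K\<^esub> d z)"
    using is_bilinear_comp_args[OF is_bilinear_functional_left[OF C.base_vector_space C.base_vector_space is_linear_id] c d]
    by simp
  define cd where "cd = tensor_lift K C C base (\<lambda>y z. c y \<otimes>\<^bsub>K\<^esub> d z)"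
  have cd: "is_linear K ?T base cd" unfolding cd_def by (rule CC.tensor_lift_linear[OF C.base_vector_space bcd])
  have cd_pure: "cd (pure_tensor K C C y z) = c y \<otimes>\<^bsub>K\<^esub> d z" if "y \<in> carrier C" "z \<in> carrier C" for y z
    unfolding cd_def by (rule CC.tensor_lift_pure[OF C.base_vector_space bcd that])
  have bphi: "is_bilinear K M ?T M (\<lambda>x u. cd u \<odot>\<^bsub>M\<^esub> x)"
    by (rule is_bilinear_functional_right[OF vector_space T cd])
  define phi where "phi = tensor_lift K M ?T M (\<lambda>x u. cd u \<odot>\<^bsub>M\<^esub> x)"
  have phi: "is_linear K ?MT M phi" unfolding phi_def by (rule MT.tensor_lift_linear[OF vector_space bphi])
  have phi_pure: "phi (pure_tensor K M ?T x u) = cd u \<odot>\<^bsub>M\<^esub> x" if "x \<in> carrier M" "u \<in> carrier ?T" for x u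
    unfolding phi_def by (rule MT.tensor_lift_pure[OF vector_space bphi that])
  have right: "phi (tensor_map K M C M ?T (\<lambda>x\<in>carrier M. x) (comult C) (coact M m))
      = act (\<lambda>x. cd (comult C x)) m"
    unfolding phi_def dual_left_act_def
      MC.tensor_lift_tensor_map[OF vector_space T idM comult vector_space bphi coact_closed[OF m]]
    by (rule fun_cong[OF tensor_lift_cong]) simp
  have bin: "is_bilinear K M C ?MT (\<lambda>x y. pure_tensor K M ?T x (pure_tensor K C C y z))" if "z \<in> carrier C" for z
    using is_bilinear_comp_args[OF MT.pure_tensor_bilinear is_linear_id is_bilinear_left[OF CC.pure_tensor_bilinear that]] .
  \<comment> \<open>\<open>inner (x \<otimes> y) z = x \<otimes> (y \<otimes> z)\<close>, the bilinear map whose lift is the associator.\<close>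
  define inner where "inner t z = tensor_lift K M C ?MT
      (\<lambda>x y. pure_tensor K M ?T x (pure_tensor K C C y z)) t" for t z
  have inner: "is_bilinear K (tensor K M C) C ?MT inner"
    unfolding is_bilinear_def
  proof (intro conjI ballI)
    show "is_linear K C ?MT (inner t)" if "t \<in> carrier (tensor K M C)" for t
      unfolding inner_def
    proof (rule MC.tensor_lift_parameter_linear[OF C.vector_space MT.tensor_module _ _ that])
      show "is_linear K C ?MT (\<lambda>z. pure_tensor K M ?T x (pure_tensor K C C y z))"
        if "x \<in> carrier M" "y \<in> carrier C" for x y
        by (rule is_linear_comp[OF is_bilinear_right[OF CC.pure_tensor_bilinear that(2)]
              is_bilinear_right[OF MT.pure_tensor_bilinear that(1)]])
    qed (rule bin)
    show "is_linear K (tensor K M C) ?MT (\<lambda>t. inner t z)" if "z \<in> carrier C" for z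
      unfolding inner_def by (rule MC.tensor_lift_linear[OF MT.tensor_module bin[OF that]])
  qed
  have assoc: "tensor_assoc K M C C = tensor_lift K (tensor K M C) C ?MT inner"
    unfolding tensor_assoc_def Let_def inner_def ..
  have phi_inner: "phi (inner (coact M x) z) = d z \<odot>\<^bsub>M\<^esub> act c x"
    if x: "x \<in> carrier M" and z: "z \<in> carrier C" for x z
  proof -
    have "phi (inner (coact M x) z)
        = tensor_lift K M C M (\<lambda>x y. phi (pure_tensor K M ?T x (pure_tensor K C C y z))) (coact M x)"
      unfolding inner_def by (rule MC.linear_tensor_lift[OF MT.tensor_module vector_space bin[OF z] phi coact_closed[OF x]])
    also have "\<dots> = tensor_lift K M C M (\<lambda>x y. d z \<odot>\<^bsub>M\<^esub> (c y \<odot>\<^bsub>M\<^esub> x)) (coact M x)"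
    proof (rule fun_cong[OF tensor_lift_cong])
      fix x y assume xy: "x \<in> carrier M" "y \<in> carrier C"
      have "pure_tensor K C C y z \<in> carrier ?T"
        using is_linear_closed[OF is_bilinear_left[OF CC.pure_tensor_bilinear z] xy(2)] .
      then show "phi (pure_tensor K M ?T x (pure_tensor K C C y z)) = d z \<odot>\<^bsub>M\<^esub> (c y \<odot>\<^bsub>M\<^esub> x)"
        using xy z is_linear_closed[OF c] is_linear_closed[OF d]
        by (simp add: phi_pure cd_pure C.scalar_commute flip: module.smult_assoc1[OF vector_space])
    qed
    also have "\<dots> = d z \<odot>\<^bsub>M\<^esub> act c x"
      unfolding dual_left_act_def
      using MC.linear_tensor_lift[OF vector_space vector_space
          is_bilinear_functional_right[OF vector_space C.vector_space c]
          is_linear_scale[OF vector_space] coact_closed[OF x], of "d z"] is_linear_closed[OF d z]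
      by simp
    finally show ?thesis .
  qed
  have "phi (tensor_assoc K M C C (tensor_map K M C (tensor K M C) C (coact M) (\<lambda>x\<in>carrier C. x) (coact M m)))
      = phi (tensor_lift K M C ?MT (\<lambda>x z. inner (coact M x) ((\<lambda>x\<in>carrier C. x) z)) (coact M m))"
    unfolding assoc
    by (simp only: MC.tensor_lift_tensor_map[OF MCm C.vector_space coact_is_linear idC MT.tensor_module inner coact_closed[OF m]])
  also have "\<dots> = tensor_lift K M C M (\<lambda>x z. phi (inner (coact M x) ((\<lambda>x\<in>carrier C. x) z))) (coact M m)"
    by (rule MC.linear_tensor_lift[OF MT.tensor_module vector_space _ phi coact_closed[OF m]])
      (rule is_bilinear_comp_args[OF inner coact_is_linear idC])
  also have "\<dots> = tensor_lift K M C M (\<lambda>x z. d z \<odot>\<^bsub>M\<^esub> act c x) (coact M m)"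
    by (rule fun_cong[OF tensor_lift_cong]) (simp add: phi_inner)
  also have "\<dots> = act c (act d m)"
    by (rule linear_apply_act[OF vector_space act_linear[OF c] d m, symmetric])
  finally show ?thesis
    using right coact_coassoc[OF m] unfolding cd_def by simp
qed

end

context coalgebra
begin

text \<open>The coalgebra is a comodule over itself, so each result about comodules holds in particular for
  the left action \<open>reg.act\<close> of the dual algebra on \<open>C\<close>.\<close>

sublocale reg: comodule K C "regular_comodule C"
  rewrites "carrier (regular_comodule C) = carrier C"
    and "\<And>x y. x \<oplus>\<^bsub>regular_comodule C\<^esub> y = x \<oplus>\<^bsub>C\<^esub> y"
    and "\<And>N. lin_maps K (regular_comodule C) N = lin_maps K C N"
    and "\<And>N f. is_linear K (regular_comodule C) N f \<longleftrightarrow> is_linear K C N f"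
    and "\<And>M f. is_linear K M (regular_comodule C) f \<longleftrightarrow> is_linear K M C f"
  by (rule regular_comodule) simp_all

end

section \<open>The dual algebra\<close>

context coalgebra
begin

lemma counit_mem_dual: "counit C \<in> carrier (dual_algebra K C)"
  by (simp add: dual_carrier counit_linear)

lemma dual_separates:
  assumes "x \<in> carrier C" "y \<in> carrier C"
    and "\<And>c. c \<in> carrier (dual_algebra K C) \<Longrightarrow> c x = c y"
  shows "x = y"
  using functionals_separate[OF base_field vector_space assms(1,2)] assms(3) by (simp add: dual_carrier)

text \<open>The convolution product is precomposition with the left action of the second factor on \<open>C\<close>.
  Associativity of the dual algebra thus reduces to that of the action.\<close>

lemma dual_mult:
  assumes c: "c \<in> carrier (dual_algebra K C)" and d: "d \<in> carrier (dual_algebra K C)"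
  shows "c \<otimes>\<^bsub>dual_algebra K C\<^esub> d = (\<lambda>x\<in>carrier C. c (reg.act d x))"
proof (rule ext)
  fix x
  have "tensor_lift K C C base (\<lambda>x1 x2. c x1 \<otimes>\<^bsub>K\<^esub> d x2) = tensor_lift K C C base (\<lambda>x1 x2. d x2 \<otimes>\<^bsub>K\<^esub> c x1)"
    using is_linear_closed[OF dual_linear[OF c]] is_linear_closed[OF dual_linear[OF d]]
    by (intro tensor_lift_cong) (simp add: scalar_commute)
  then show "(c \<otimes>\<^bsub>dual_algebra K C\<^esub> d) x = (\<lambda>x\<in>carrier C. c (reg.act d x)) x"
    using reg.linear_apply_act[OF base_vector_space dual_linear[OF c] dual_linear[OF d]]
    by (simp add: dual_algebra_def)
qed

lemma dual_mult_apply: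
  assumes "c \<in> carrier (dual_algebra K C)" "d \<in> carrier (dual_algebra K C)" "x \<in> carrier C"
  shows "(c \<otimes>\<^bsub>dual_algebra K C\<^esub> d) x = c (reg.act d x)"
  using assms by (simp add: dual_mult)

end

context comodule
begin

lemma act_mult:
  assumes c: "c \<in> carrier (dual_algebra K C)" and d: "d \<in> carrier (dual_algebra K C)" and m: "m \<in> carrier M"
  shows "act (c \<otimes>\<^bsub>dual_algebra K C\<^esub> d) m = act c (act d m)"
  unfolding act_iterated[OF C.dual_linear[OF c] C.dual_linear[OF d] m]
  unfolding dual_left_act_def
  by (rule fun_cong[OF tensor_lift_cong]) (simp add: dual_algebra_def)

text \<open>With \<open>c = \<epsilon>\<close> this says that scalars act through the multiples of the counit, so additive maps that
  commute with the dual algebra are automatically \<open>K\<close>-linear.\<close>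

lemma act_smult:
  assumes c: "c \<in> carrier (dual_algebra K C)" and a: "a \<in> carrier K" and m: "m \<in> carrier M"
  shows "act (\<lambda>x\<in>carrier C. a \<otimes>\<^bsub>K\<^esub> c x) m = a \<odot>\<^bsub>M\<^esub> act c m"
proof -
  note lc = C.dual_linear[OF c]
  have "tensor_lift K M C M (\<lambda>m0 m1. (\<lambda>x\<in>carrier C. a \<otimes>\<^bsub>K\<^esub> c x) m1 \<odot>\<^bsub>M\<^esub> m0)
      = tensor_lift K M C M (\<lambda>m0 m1. c m1 \<odot>\<^bsub>M\<^esub> (a \<odot>\<^bsub>M\<^esub> m0))"
    using is_linear_closed[OF lc] a
    by (intro tensor_lift_cong) (simp add: C.scalar_commute flip: module.smult_assoc1[OF vector_space])
  then show ?thesis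
    using linear_apply_act[OF vector_space is_linear_scale[OF vector_space a] lc m]
    by (simp add: dual_left_act_def)
qed

lemma functional_act_closed:
  assumes g: "g \<in> lin_maps K M base" and c: "c \<in> carrier (dual_algebra K C)"
  shows "(\<lambda>m\<in>carrier M. g (act c m)) \<in> lin_maps K M base"
  using g is_linear_comp[OF act_linear[OF C.dual_linear[OF c]], of base g]
  by (intro restrict_mem_lin_maps[OF vector_space]) (simp add: lin_maps_iff)

end

context coalgebra
begin

lemma dual_mult_closed:
  assumes "c \<in> carrier (dual_algebra K C)" "d \<in> carrier (dual_algebra K C)"
  shows "c \<otimes>\<^bsub>dual_algebra K C\<^esub> d \<in> carrier (dual_algebra K C)"
  using reg.functional_act_closed assms by (simp add: dual_mult dual_carrier)

lemma dual_add_apply: "x \<in> carrier C \<Longrightarrow> (c \<oplus>\<^bsub>dual_algebra K C\<^esub> d) x = c x \<oplus>\<^bsub>K\<^esub> d x"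
  by (simp add: dual_add)

text \<open>The counit axiom \<open>\<Sum> \<epsilon>(x\<^sub>1) x\<^sub>2 = x\<close> says \<open>x \<cdot> \<epsilon> = x\<close>; pairing with \<open>d\<close> transfers it to the left
  action.\<close>

lemma counit_act:
  assumes "d \<in> carrier (dual_algebra K C)" "x \<in> carrier C"
  shows "counit C (reg.act d x) = d x"
proof -
  have "coefficient K C (regular_comodule C) (counit C) x = x"
    using counit_left[OF assms(2)] by (simp add: coefficient_def)
  then show ?thesis
    using reg.functional_coefficient[OF dual_linear[OF assms(1)] dual_linear[OF counit_mem_dual] assms(2)] by simp
qed

lemma dual_algebra_ring: "ring (dual_algebra K C)"
proof (rule ringI)
  let ?A = "dual_algebra K C"
  show "abelian_group ?A"
    by (rule lin_maps_pointwise_abelian_group[OF vector_space base_vector_space])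
      (simp_all add: dual_carrier dual_zero dual_add)
  show "monoid ?A"
  proof
    show "c \<otimes>\<^bsub>?A\<^esub> d \<otimes>\<^bsub>?A\<^esub> e = c \<otimes>\<^bsub>?A\<^esub> (d \<otimes>\<^bsub>?A\<^esub> e)"
      if cde: "c \<in> carrier ?A" "d \<in> carrier ?A" "e \<in> carrier ?A" for c d e
      using cde
      by (intro dual_eqI dual_mult_closed)
        (simp_all add: dual_mult_apply dual_mult_closed reg.act_mult reg.act_closed)
    show "\<one>\<^bsub>?A\<^esub> \<otimes>\<^bsub>?A\<^esub> d = d" if d: "d \<in> carrier ?A" for d
      using d counit_mem_dual
      by (intro dual_eqI dual_mult_closed) (simp_all add: dual_one dual_mult_apply counit_act)
    show "c \<otimes>\<^bsub>?A\<^esub> \<one>\<^bsub>?A\<^esub> = c" if c: "c \<in> carrier ?A" for c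
      using c counit_mem_dual
      by (intro dual_eqI dual_mult_closed) (simp_all add: dual_one dual_mult_apply reg.act_counit)
  qed (use dual_mult_closed counit_mem_dual in \<open>simp_all add: dual_one\<close>)
  show "(c \<oplus>\<^bsub>?A\<^esub> d) \<otimes>\<^bsub>?A\<^esub> e = c \<otimes>\<^bsub>?A\<^esub> e \<oplus>\<^bsub>?A\<^esub> d \<otimes>\<^bsub>?A\<^esub> e"
    if cde: "c \<in> carrier ?A" "d \<in> carrier ?A" "e \<in> carrier ?A" for c d e
    using cde
    by (intro dual_eqI dual_mult_closed dual_add_closed)
      (simp_all add: dual_mult_apply dual_mult_closed dual_add_closed dual_add_apply reg.act_closed)
  show "e \<otimes>\<^bsub>?A\<^esub> (c \<oplus>\<^bsub>?A\<^esub> d) = e \<otimes>\<^bsub>?A\<^esub> c \<oplus>\<^bsub>?A\<^esub> e \<otimes>\<^bsub>?A\<^esub> d"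
    if cde: "c \<in> carrier ?A" "d \<in> carrier ?A" "e \<in> carrier ?A" for c d e
    using cde is_linear_add[OF dual_linear[OF cde(3)]]
    by (intro dual_eqI dual_mult_closed dual_add_closed)
      (simp_all add: dual_mult_apply dual_mult_closed dual_add_closed dual_add_apply reg.act_closed reg.act_add)
qed

end

section \<open>Matrix coefficients are equivariant\<close>

context comodule
begin

lemma functional_linear: "g \<in> lin_maps K M base \<Longrightarrow> is_linear K M base g"
  by (simp add: lin_maps_iff)

lemma pairing:
  assumes "c \<in> carrier (dual_algebra K C)" "g \<in> lin_maps K M base" "m \<in> carrier M"
  shows "c (coefficient K C M g m) = g (act c m)"
  using functional_coefficient[OF C.dual_linear[OF assms(1)] functional_linear[OF assms(2)] assms(3)] .

text \<open>After pairing with \<open>c\<close> both sides equal \<open>g (c \<cdot> (d \<cdot> m)) = g ((c d) \<cdot> m)\<close>. For the regular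
  comodule this is the bimodule identity \<open>(d \<cdot> x) \<cdot> g = d \<cdot> (x \<cdot> g)\<close>.\<close>

lemma coefficient_act:
  assumes g: "g \<in> lin_maps K M base" and d: "d \<in> carrier (dual_algebra K C)" and m: "m \<in> carrier M"
  shows "coefficient K C M g (act d m) = C.reg.act d (coefficient K C M g m)"
proof (rule C.dual_separates)
  fix c assume c: "c \<in> carrier (dual_algebra K C)"
  have "c (C.reg.act d (coefficient K C M g m)) = (c \<otimes>\<^bsub>dual_algebra K C\<^esub> d) (coefficient K C M g m)"
    using coefficient_closed[OF g m] by (simp add: C.dual_mult[OF c d])
  also have "\<dots> = g (act c (act d m))"
    by (simp add: pairing[OF C.dual_mult_closed[OF c d] g m] act_mult[OF c d m])
  finally show "c (coefficient K C M g (act d m)) = c (C.reg.act d (coefficient K C M g m))"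
    by (simp add: pairing[OF c g act_closed[OF d m]])
qed (use g d m coefficient_closed act_closed C.reg.act_closed in auto)

end

(* Re-entering the locale gives access to the preceding facts for the regular comodule. *)
context comodule
begin

text \<open>After pairing with \<open>c\<close> both sides equal \<open>g (d \<cdot> (c \<cdot> m)) = g ((d c) \<cdot> m)\<close>. For the regular
  comodule this is associativity \<open>x \<cdot> (g d) = (x \<cdot> g) \<cdot> d\<close> of the right action.\<close>

lemma coefficient_functional_act:
  assumes g: "g \<in> lin_maps K M base" and d: "d \<in> carrier (dual_algebra K C)" and m: "m \<in> carrier M"
  shows "coefficient K C M (\<lambda>m\<in>carrier M. g (act d m)) m = dual_right_act K C (coefficient K C M g m) d"
proof (rule C.dual_separates)
  note gd = functional_act_closed[OF g d]
  show "coefficient K C M (\<lambda>m\<in>carrier M. g (act d m)) m \<in> carrier C"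
    by (rule coefficient_closed[OF gd m])
  show "dual_right_act K C (coefficient K C M g m) d \<in> carrier C"
    using C.reg.coefficient_closed[of d] d coefficient_closed[OF g m]
    by (simp add: dual_right_act_eq_coefficient C.dual_carrier)
  fix c assume c: "c \<in> carrier (dual_algebra K C)"
  have "c (dual_right_act K C (coefficient K C M g m) d) = (d \<otimes>\<^bsub>dual_algebra K C\<^esub> c) (coefficient K C M g m)"
    using C.reg.pairing[of c d] c d coefficient_closed[OF g m]
    by (simp add: dual_right_act_eq_coefficient C.dual_carrier C.dual_mult)
  also have "\<dots> = g (act d (act c m))"
    by (simp add: pairing[OF C.dual_mult_closed[OF d c] g m] act_mult[OF d c m])
  finally show "c (coefficient K C M (\<lambda>m\<in>carrier M. g (act d m)) m) = c (dual_right_act K C (coefficient K C M g m) d)"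
    by (simp add: pairing[OF c gd m] act_closed[OF c m])
qed

lemma functional_add_closed:
  assumes "g \<in> lin_maps K M base" "h \<in> lin_maps K M base"
  shows "(\<lambda>m\<in>carrier M. g m \<oplus>\<^bsub>K\<^esub> h m) \<in> lin_maps K M base"
  using is_linear_pointwise_add[OF vector_space C.base_vector_space functional_linear[OF assms(1)] functional_linear[OF assms(2)]]
  by (intro restrict_mem_lin_maps[OF vector_space]) simp

lemma coefficient_add:
  assumes g: "g \<in> lin_maps K M base" and h: "h \<in> lin_maps K M base" and m: "m \<in> carrier M"
  shows "coefficient K C M (\<lambda>m\<in>carrier M. g m \<oplus>\<^bsub>K\<^esub> h m) m = coefficient K C M g m \<oplus>\<^bsub>C\<^esub> coefficient K C M h m"
proof (rule C.dual_separates)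
  note gh = functional_add_closed[OF g h]
  show "coefficient K C M (\<lambda>m\<in>carrier M. g m \<oplus>\<^bsub>K\<^esub> h m) m \<in> carrier C"
    by (rule coefficient_closed[OF gh m])
  show "coefficient K C M g m \<oplus>\<^bsub>C\<^esub> coefficient K C M h m \<in> carrier C"
    using coefficient_closed[OF g m] coefficient_closed[OF h m] by simp
  fix c assume c: "c \<in> carrier (dual_algebra K C)"
  show "c (coefficient K C M (\<lambda>m\<in>carrier M. g m \<oplus>\<^bsub>K\<^esub> h m) m) =
      c (coefficient K C M g m \<oplus>\<^bsub>C\<^esub> coefficient K C M h m)"
    using is_linear_add[OF C.dual_linear[OF c] coefficient_closed[OF g m] coefficient_closed[OF h m]]
    by (simp add: pairing[OF c _ m] g h gh act_closed[OF c m])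
qed

lemma counit_coefficient:
  assumes "g \<in> lin_maps K M base" "m \<in> carrier M"
  shows "counit C (coefficient K C M g m) = g m"
  using pairing[OF C.counit_mem_dual assms] act_counit[OF assms(2)] by simp

end

section \<open>The right modules of functionals and of equivariant maps\<close>

context comodule
begin

lemma G_carrier_iff:
  "f \<in> carrier (G_obj K C M) \<longleftrightarrow> f \<in> extensional (carrier M) \<and>
    (\<forall>m\<in>carrier M. f m \<in> carrier C) \<and>
    (\<forall>x\<in>carrier M. \<forall>y\<in>carrier M. f (x \<oplus>\<^bsub>M\<^esub> y) = f x \<oplus>\<^bsub>C\<^esub> f y) \<and>
    (\<forall>c\<in>carrier (dual_algebra K C). \<forall>m\<in>carrier M. f (act c m) = C.reg.act c (f m))"
  by (auto simp: G_obj_def left_module_maps_def dual_left_module_def PiE_def)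

lemma F_simps:
  "carrier (F_obj K C M) = lin_maps K M base"
  "\<zero>\<^bsub>F_obj K C M\<^esub> = (\<lambda>m\<in>carrier M. \<zero>\<^bsub>K\<^esub>)"
  "g \<oplus>\<^bsub>F_obj K C M\<^esub> h = (\<lambda>m\<in>carrier M. g m \<oplus>\<^bsub>K\<^esub> h m)"
  "ract (F_obj K C M) g c = (\<lambda>m\<in>carrier M. g (act c m))"
  by (simp_all add: F_obj_def)

lemma G_simps:
  "\<zero>\<^bsub>G_obj K C M\<^esub> = (\<lambda>m\<in>carrier M. \<zero>\<^bsub>C\<^esub>)"
  "f \<oplus>\<^bsub>G_obj K C M\<^esub> h = (\<lambda>m\<in>carrier M. f m \<oplus>\<^bsub>C\<^esub> h m)"
  "ract (G_obj K C M) f c = (\<lambda>m\<in>carrier M. dual_right_act K C (f m) c)"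
  by (simp_all add: G_obj_def)

lemma F_right_module: "right_module (dual_algebra K C) (F_obj K C M)"
proof (rule right_module.intro)
  show "ring (dual_algebra K C)" by (rule C.dual_algebra_ring)
  show "abelian_group (F_obj K C M)"
    by (rule lin_maps_pointwise_abelian_group[OF vector_space C.base_vector_space]) (simp_all add: F_simps)
  show "ract (F_obj K C M) g c \<in> carrier (F_obj K C M)"
    if "g \<in> carrier (F_obj K C M)" "c \<in> carrier (dual_algebra K C)" for g c
    using functional_act_closed that by (simp add: F_simps)
  show "ract (F_obj K C M) g (c \<oplus>\<^bsub>dual_algebra K C\<^esub> d) =
      ract (F_obj K C M) g c \<oplus>\<^bsub>F_obj K C M\<^esub> ract (F_obj K C M) g d"
    if "g \<in> carrier (F_obj K C M)" "c \<in> carrier (dual_algebra K C)" "d \<in> carrier (dual_algebra K C)" for g c d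
    using that is_linear_add[OF functional_linear[of g]]
    by (auto simp: F_simps act_add act_closed)
  show "ract (F_obj K C M) g \<one>\<^bsub>dual_algebra K C\<^esub> = g" if "g \<in> carrier (F_obj K C M)" for g
    using that by (auto simp: F_simps C.dual_one act_counit lin_maps_iff extensional_def)
qed (auto simp: F_simps act_mult act_closed)

lemma G_right_module: "right_module (dual_algebra K C) (G_obj K C M)"
proof (rule right_module.intro)
  let ?A = "dual_algebra K C"
  have C_group: "abelian_group C" by (rule module.axioms(2)[OF C.vector_space])
  note reg_linear = C.reg.act_linear[OF C.dual_linear]
  note reg_closed = C.reg.act_closed
  note racl = C.reg.coefficient_linear[OF C.dual_linear]
  have rac: "dual_right_act K C x c \<in> carrier C" if "x \<in> carrier C" "c \<in> carrier ?A" for x c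
    using is_linear_closed[OF racl[OF that(2)] that(1)] by (simp add: dual_right_act_eq_coefficient)
  have rac_add: "dual_right_act K C (x \<oplus>\<^bsub>C\<^esub> y) c = dual_right_act K C x c \<oplus>\<^bsub>C\<^esub> dual_right_act K C y c"
    if "x \<in> carrier C" "y \<in> carrier C" "c \<in> carrier ?A" for x y c
    using is_linear_add[OF racl[OF that(3)] that(1,2)] by (simp add: dual_right_act_eq_coefficient)
  show "ring ?A" by (rule C.dual_algebra_ring)
  show "abelian_group (G_obj K C M)"
  proof (rule pointwise_abelian_group[OF C_group _ _ G_simps(1,2)])
    show "(\<lambda>m\<in>carrier M. \<zero>\<^bsub>C\<^esub>) \<in> carrier (G_obj K C M)"
      using is_linear_zero[OF C.vector_space C.vector_space reg_linear]
      by (simp add: G_carrier_iff act_closed)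
    show "(\<lambda>m\<in>carrier M. f m \<oplus>\<^bsub>C\<^esub> h m) \<in> carrier (G_obj K C M)"
      if "f \<in> carrier (G_obj K C M)" "h \<in> carrier (G_obj K C M)" for f h
      using that by (simp add: G_carrier_iff act_closed is_linear_add[OF reg_linear] abelian_monoid.add_middle_swap[OF abelian_group.axioms(1)[OF C_group]])
    show "(\<lambda>m\<in>carrier M. \<ominus>\<^bsub>C\<^esub> f m) \<in> carrier (G_obj K C M)" if "f \<in> carrier (G_obj K C M)" for f
      using that by (simp add: G_carrier_iff act_closed is_linear_uminus[OF C.vector_space C.vector_space reg_linear]
          abelian_group.minus_add[OF C_group])
  qed (auto simp: G_carrier_iff)
  show "ract (G_obj K C M) f c \<in> carrier (G_obj K C M)"
    if f: "f \<in> carrier (G_obj K C M)" and c: "c \<in> carrier ?A" for f c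
  proof -
    have "dual_right_act K C (C.reg.act d x) c = C.reg.act d (dual_right_act K C x c)"
      if "d \<in> carrier ?A" "x \<in> carrier C" for d x
      using C.reg.coefficient_act[of c d x] that c by (simp add: dual_right_act_eq_coefficient C.dual_carrier)
    then show ?thesis using f c by (simp add: G_carrier_iff G_simps rac rac_add act_closed)
  qed
  show "ract (G_obj K C M) (f \<oplus>\<^bsub>G_obj K C M\<^esub> h) c =
      ract (G_obj K C M) f c \<oplus>\<^bsub>G_obj K C M\<^esub> ract (G_obj K C M) h c"
    if "f \<in> carrier (G_obj K C M)" "h \<in> carrier (G_obj K C M)" "c \<in> carrier ?A" for f h c
    using that by (auto simp: G_simps G_carrier_iff rac_add)
  show "ract (G_obj K C M) f (c \<oplus>\<^bsub>?A\<^esub> d) =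
      ract (G_obj K C M) f c \<oplus>\<^bsub>G_obj K C M\<^esub> ract (G_obj K C M) f d"
    if "f \<in> carrier (G_obj K C M)" "c \<in> carrier ?A" "d \<in> carrier ?A" for f c d
    using that C.reg.coefficient_add[of c d]
    by (auto simp: G_simps G_carrier_iff dual_right_act_eq_coefficient C.dual_add C.dual_carrier)
  show "ract (G_obj K C M) f (c \<otimes>\<^bsub>?A\<^esub> d) = ract (G_obj K C M) (ract (G_obj K C M) f c) d"
    if "f \<in> carrier (G_obj K C M)" "c \<in> carrier ?A" "d \<in> carrier ?A" for f c d
    using that C.reg.coefficient_functional_act[of c d]
    by (auto simp: G_simps G_carrier_iff dual_right_act_eq_coefficient C.dual_mult C.dual_carrier)
  show "ract (G_obj K C M) f \<one>\<^bsub>?A\<^esub> = f" if "f \<in> carrier (G_obj K C M)" for f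
    using that C.counit_left by (auto simp: G_simps G_carrier_iff C.dual_one dual_right_act_def extensional_def)
qed

lemma counit_equivariant_linear:
  assumes f: "f \<in> carrier (G_obj K C M)"
  shows "(\<lambda>m\<in>carrier M. counit C (f m)) \<in> lin_maps K M base"
proof (rule restrict_mem_lin_maps[OF vector_space])
  have e: "is_linear K C base (counit C)" by (rule C.dual_linear[OF C.counit_mem_dual])
  have fc: "f m \<in> carrier C" if "m \<in> carrier M" for m using f that by (simp add: G_carrier_iff)
  have "f (a \<odot>\<^bsub>M\<^esub> m) = a \<odot>\<^bsub>C\<^esub> f m" if a: "a \<in> carrier K" and m: "m \<in> carrier M" for a m
  proof -
    define c where "c = (\<lambda>x\<in>carrier C. a \<otimes>\<^bsub>K\<^esub> counit C x)"
    have c: "c \<in> carrier (dual_algebra K C)"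
      unfolding c_def C.dual_carrier
      using is_linear_comp[OF e is_linear_scale[OF C.base_vector_space a]]
      by (intro restrict_mem_lin_maps[OF C.vector_space]) simp
    have "f (a \<odot>\<^bsub>M\<^esub> m) = f (act c m)"
      unfolding c_def using act_smult[OF C.counit_mem_dual a m] act_counit[OF m] by simp
    also have "\<dots> = C.reg.act c (f m)" using f c m by (simp add: G_carrier_iff)
    also have "\<dots> = a \<odot>\<^bsub>C\<^esub> f m"
      unfolding c_def
      using C.reg.act_smult[OF C.counit_mem_dual a fc[OF m]] C.reg.act_counit[OF fc[OF m]] by simp
    finally show ?thesis .
  qed
  then show "is_linear K M base (\<lambda>m. counit C (f m))"
    using f fc by (intro is_linear_comp[OF _ e]) (simp add: is_linear_def G_carrier_iff)
qed

text \<open>For a functional \<open>c\<close>, equivariance of \<open>f\<close> gives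
  \<open>c (f m) = \<epsilon> (c \<cdot> f m) = \<epsilon> (f (c \<cdot> m))\<close>, which is the pairing of \<open>c\<close> with the coefficient of
  \<open>\<epsilon> \<circ> f\<close> at \<open>m\<close>. So an equivariant map is recovered from its composite with the counit.\<close>

lemma equivariant_eq_coefficient:
  assumes f: "f \<in> carrier (G_obj K C M)" and m: "m \<in> carrier M"
  shows "coefficient K C M (\<lambda>m\<in>carrier M. counit C (f m)) m = f m"
proof (rule C.dual_separates)
  note g = counit_equivariant_linear[OF f]
  have fm: "f m \<in> carrier C" using f m by (simp add: G_carrier_iff)
  then show "f m \<in> carrier C" .
  show "coefficient K C M (\<lambda>m\<in>carrier M. counit C (f m)) m \<in> carrier C"
    by (rule coefficient_closed[OF g m])
  fix c assume c: "c \<in> carrier (dual_algebra K C)"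
  have "c (coefficient K C M (\<lambda>m\<in>carrier M. counit C (f m)) m) = counit C (f (act c m))"
    using pairing[OF c g m] act_closed[OF c m] by simp
  also have "\<dots> = counit C (C.reg.act c (f m))" using f c m by (simp add: G_carrier_iff)
  also have "\<dots> = c (f m)" by (rule C.counit_act[OF c fm])
  finally show "c (coefficient K C M (\<lambda>m\<in>carrier M. counit C (f m)) m) = c (f m)" .
qed

definition coefficient_map where "coefficient_map = (\<lambda>g\<in>lin_maps K M base. \<lambda>m\<in>carrier M. coefficient K C M g m)"

lemma coefficient_map_closed:
  assumes g: "g \<in> lin_maps K M base"
  shows "coefficient_map g \<in> carrier (G_obj K C M)"
  using g coefficient_closed[OF g] is_linear_add[OF coefficient_linear[OF functional_linear[OF g]]]
  by (simp add: coefficient_map_def G_carrier_iff act_closed coefficient_act)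

lemma coefficient_map_iso: "coefficient_map \<in> rmodule_iso (dual_algebra K C) (F_obj K C M) (G_obj K C M)"
proof -
  have "coefficient_map \<in> rmodule_maps (dual_algebra K C) (F_obj K C M) (G_obj K C M)"
  proof -
    have "coefficient_map \<in> carrier (F_obj K C M) \<rightarrow>\<^sub>E carrier (G_obj K C M)"
      using coefficient_map_closed by (auto simp: F_simps coefficient_map_def)
    then show ?thesis
      unfolding rmodule_maps_def
      by (auto simp: F_simps G_simps coefficient_map_def functional_add_closed functional_act_closed
          coefficient_add coefficient_functional_act)
  qed
  moreover have "bij_betw coefficient_map (carrier (F_obj K C M)) (carrier (G_obj K C M))"
  proof (rule bij_betwI)
    let ?inv = "\<lambda>f. \<lambda>m\<in>carrier M. counit C (f m)"
    show "coefficient_map \<in> carrier (F_obj K C M) \<rightarrow> carrier (G_obj K C M)"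
      using coefficient_map_closed by (simp add: F_simps)
    show "?inv \<in> carrier (G_obj K C M) \<rightarrow> carrier (F_obj K C M)"
      using counit_equivariant_linear by (simp add: F_simps)
    show "?inv (coefficient_map g) = g" if "g \<in> carrier (F_obj K C M)" for g
      using that by (auto simp: F_simps coefficient_map_def counit_coefficient lin_maps_iff[of g] extensional_def)
    show "coefficient_map (?inv f) = f" if "f \<in> carrier (G_obj K C M)" for f
      using that counit_equivariant_linear[OF that]
      by (auto simp: coefficient_map_def equivariant_eq_coefficient G_carrier_iff extensional_def)
  qed
  ultimately show ?thesis by (simp add: rmodule_iso_def)
qed

end

section \<open>Comodule maps\<close>

context
  fixes K :: "('k, 'z) ring_scheme" and C :: "('k, 'c) coalgebra"
    and M :: "('k, 'm, 'c) comodule" and N :: "('k, 'n, 'c) comodule" and f :: "'m \<Rightarrow> 'n"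
  assumes M: "comodule K C M" and N: "comodule K C N" and f: "f \<in> comodule_maps K C M N"
begin

interpretation M: comodule K C M by (rule M)
interpretation N: comodule K C N by (rule N)

lemma comodule_map_linear: "is_linear K M N f"
  using f by (simp add: comodule_maps_def lin_maps_iff)

lemma comodule_map_closed: "m \<in> carrier M \<Longrightarrow> f m \<in> carrier N"
  using is_linear_closed[OF comodule_map_linear] .

text \<open>Both sides are \<open>\<Sum> c(m\<^sub>1) f(m\<^sub>0)\<close>, because \<open>f\<close> intertwines the coactions.\<close>

lemma comodule_map_act:
  assumes c: "c \<in> carrier (dual_algebra K C)" and m: "m \<in> carrier M"
  shows "f (dual_left_act K C M c m) = dual_left_act K C N c (f m)"
proof -
  note lc = M.C.dual_linear[OF c]
  note idC = is_linear_restrict_id[OF M.C.vector_space]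
  have "dual_left_act K C N c (f m) = tensor_lift K N C N (\<lambda>m0 m1. c m1 \<odot>\<^bsub>N\<^esub> m0)
      (tensor_map K M C N C f (\<lambda>c\<in>carrier C. c) (coact M m))"
    using f m by (simp add: dual_left_act_def comodule_maps_def)
  also have "\<dots> = tensor_lift K M C N (\<lambda>m0 m1. c ((\<lambda>x\<in>carrier C. x) m1) \<odot>\<^bsub>N\<^esub> f m0) (coact M m)"
    by (rule M.MC.tensor_lift_tensor_map[OF N.vector_space M.C.vector_space comodule_map_linear idC
          N.vector_space is_bilinear_functional_right[OF N.vector_space M.C.vector_space lc] M.coact_closed[OF m]])
  also have "\<dots> = tensor_lift K M C N (\<lambda>m0 m1. c m1 \<odot>\<^bsub>N\<^esub> f m0) (coact M m)"
    by (rule fun_cong[OF tensor_lift_cong]) simp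
  also have "\<dots> = f (dual_left_act K C M c m)"
    by (rule M.linear_apply_act[OF N.vector_space comodule_map_linear lc m, symmetric])
  finally show ?thesis by simp
qed

lemma functional_compose:
  assumes "g \<in> carrier (F_obj K C N)"
  shows "compose (carrier M) g f \<in> carrier (F_obj K C M)"
  using is_linear_comp[OF comodule_map_linear N.functional_linear[of g]] assms restrict_mem_lin_maps[OF M.vector_space]
  by (simp add: M.F_simps N.F_simps compose_def)

lemma equivariant_compose:
  assumes "g \<in> carrier (G_obj K C N)"
  shows "compose (carrier M) g f \<in> carrier (G_obj K C M)"
  using assms comodule_map_act comodule_map_closed is_linear_add[OF comodule_map_linear]
    module.axioms(2)[OF M.vector_space]
  by (simp add: M.G_carrier_iff N.G_carrier_iff compose_def M.act_closed abelian_groupE(1))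

text \<open>Naturality of the matrix coefficients: both sides pair with \<open>c\<close> to \<open>g (c \<cdot> f m)\<close>.\<close>

lemma coefficient_compose:
  assumes g: "g \<in> lin_maps K N (base_module K)" and m: "m \<in> carrier M"
  shows "coefficient K C M (compose (carrier M) g f) m = coefficient K C N g (f m)"
proof (rule M.C.dual_separates)
  have gf: "compose (carrier M) g f \<in> lin_maps K M (base_module K)"
    using functional_compose[of g] g by (simp add: M.F_simps N.F_simps)
  note fm = comodule_map_closed[OF m]
  show "coefficient K C M (compose (carrier M) g f) m \<in> carrier C" by (rule M.coefficient_closed[OF gf m])
  show "coefficient K C N g (f m) \<in> carrier C" by (rule N.coefficient_closed[OF g fm])
  fix c assume c: "c \<in> carrier (dual_algebra K C)"
  show "c (coefficient K C M (compose (carrier M) g f) m) = c (coefficient K C N g (f m))"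
    unfolding M.pairing[OF c gf m] N.pairing[OF c g fm] comodule_map_act[OF c m, symmetric]
    using M.act_closed[OF c m] by (simp add: compose_def)
qed

end

lemma comodule_map_compose:
  assumes M: "comodule K C M" and N: "comodule K C N" and P: "comodule K C P"
    and f: "f \<in> comodule_maps K C M N" and g: "g \<in> comodule_maps K C N P"
  shows "compose (carrier M) g f \<in> comodule_maps K C M P"
proof -
  interpret M: comodule K C M by (rule M)
  interpret N: comodule K C N by (rule N)
  interpret P: comodule K C P by (rule P)
  let ?id = "\<lambda>c\<in>carrier C. c"
  note lf = comodule_map_linear[OF M N f] and lg = comodule_map_linear[OF N P g]
  note idC = is_linear_restrict_id[OF M.C.vector_space]
  have "coact P (g (f m)) = tensor_map K M C P C (compose (carrier M) g f) ?id (coact M m)"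
    if m: "m \<in> carrier M" for m
  proof -
    have "coact P (g (f m)) = tensor_map K N C P C g ?id (tensor_map K M C N C f ?id (coact M m))"
      using f g m comodule_map_closed[OF M N f m] by (simp add: comodule_maps_def)
    also have "\<dots> = tensor_lift K M C (tensor K P C) (\<lambda>x y. pure_tensor K P C (g (f x)) (?id (?id y))) (coact M m)"
      unfolding tensor_map_def[of K N]
      by (rule M.MC.tensor_lift_tensor_map[OF N.vector_space M.C.vector_space lf idC P.MC.tensor_module
            is_bilinear_comp_args[OF P.MC.pure_tensor_bilinear lg idC] M.coact_closed[OF m]])
    also have "\<dots> = tensor_map K M C P C (compose (carrier M) g f) ?id (coact M m)"
      unfolding tensor_map_def by (rule fun_cong[OF tensor_lift_cong]) (simp add: compose_def)
    finally show ?thesis .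
  qed
  moreover have "compose (carrier M) g f \<in> lin_maps K M P"
    unfolding compose_def by (rule restrict_mem_lin_maps[OF M.vector_space is_linear_comp[OF lf lg]])
  ultimately show ?thesis by (simp add: comodule_maps_def compose_def)
qed

lemma comodule_map_id:
  assumes "comodule K C M"
  shows "(\<lambda>x\<in>carrier M. x) \<in> comodule_maps K C M M"
proof -
  interpret M: comodule K C M by fact
  have "tensor_map K M C M C (\<lambda>x\<in>carrier M. x) (\<lambda>c\<in>carrier C. c) = tensor_map K M C M C (\<lambda>x. x) (\<lambda>c. c)"
    by (rule tensor_map_cong) simp_all
  then show ?thesis
    using restrict_mem_lin_maps[OF M.vector_space is_linear_id] M.MC.tensor_map_id[OF M.coact_closed]
    by (simp add: comodule_maps_def)
qed

section \<open>Categories, functors and the natural isomorphism\<close>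

lemma comodule_maps_extensional:
  "f \<in> comodule_maps K C M N \<Longrightarrow> f \<in> carrier M \<rightarrow>\<^sub>E carrier N"
  by (simp add: comodule_maps_def lin_maps_def)

lemma category_comodule_cat: "category (comodule_cat K C)"
proof (rule category.intro)
  fix A B D E f g h
  let ?C = "comodule_cat K C"
  show "Ide ?C A \<in> Hom ?C A A" if "A \<in> Ob ?C"
    using that comodule_map_id by (simp add: comodule_cat_def)
  show "Cmp ?C A B D g f \<in> Hom ?C A D"
    if "A \<in> Ob ?C" "B \<in> Ob ?C" "D \<in> Ob ?C" "f \<in> Hom ?C A B" "g \<in> Hom ?C B D"
    using that comodule_map_compose by (simp add: comodule_cat_def)
  show "Cmp ?C A A B f (Ide ?C A) = f" "Cmp ?C A B B (Ide ?C B) f = f" if "f \<in> Hom ?C A B"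
    using comodule_maps_extensional[of f K C A B] that
    by (auto simp: comodule_cat_def compose_def PiE_def Pi_def extensional_def fun_eq_iff)
  show "Cmp ?C A D E h (Cmp ?C A B D g f) = Cmp ?C A B E (Cmp ?C B D E h g) f" if "f \<in> Hom ?C A B"
    using comodule_maps_extensional[of f K C A B] that
    by (auto simp: comodule_cat_def compose_def PiE_def Pi_def)
qed

lemma category_rmodule_cat: "category (rmodule_cat R)"
proof (rule category.intro)
  fix A B D E f g h
  let ?C = "rmodule_cat R"
  show "Ide ?C A \<in> Hom ?C A A" if "A \<in> Ob ?C"
  proof -
    interpret right_module R A using that by (simp add: rmodule_cat_def)
    interpret abelian_group A by (rule abelian_group)
    show ?thesis by (simp add: rmodule_cat_def rmodule_maps_def ract_closed)
  qed
  show "Cmp ?C A B D g f \<in> Hom ?C A D"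
    if A: "A \<in> Ob ?C" and fg: "f \<in> Hom ?C A B" "g \<in> Hom ?C B D"
  proof -
    interpret right_module R A using A by (simp add: rmodule_cat_def)
    interpret abelian_group A by (rule abelian_group)
    show ?thesis
      using fg by (auto simp: rmodule_cat_def rmodule_maps_def ract_closed compose_def PiE_def Pi_def)
  qed
  show "Cmp ?C A A B f (Ide ?C A) = f" "Cmp ?C A B B (Ide ?C B) f = f" if "f \<in> Hom ?C A B"
    using that by (auto simp: rmodule_cat_def rmodule_maps_def compose_def PiE_def Pi_def extensional_def fun_eq_iff)
  show "Cmp ?C A D E h (Cmp ?C A B D g f) = Cmp ?C A B E (Cmp ?C B D E h g) f" if "f \<in> Hom ?C A B"
    using that by (auto simp: rmodule_cat_def rmodule_maps_def compose_def PiE_def Pi_def)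
qed

text \<open>Both functors act on morphisms by precomposition, for which the functor laws hold as soon as
  precomposing with a comodule map yields module homomorphisms between the values.\<close>

lemma precomposition_functor:
  assumes mod: "\<And>M :: ('k, 'm, 'c) comodule. comodule K C M \<Longrightarrow> right_module (dual_algebra K C) (X M)"
    and val: "\<And>M g. comodule K C M \<Longrightarrow> g \<in> carrier (X M) \<Longrightarrow> g \<in> extensional (carrier M)"
    and comp: "\<And>M N f g. comodule K C M \<Longrightarrow> comodule K C N \<Longrightarrow> f \<in> comodule_maps K C M N \<Longrightarrow>
      g \<in> carrier (X N) \<Longrightarrow> compose (carrier M) g f \<in> carrier (X M)"
    and hom: "\<And>M N f. comodule K C M \<Longrightarrow> comodule K C N \<Longrightarrow> f \<in> comodule_maps K C M N \<Longrightarrow>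
      (\<lambda>g\<in>carrier (X N). compose (carrier M) g f) \<in> rmodule_maps (dual_algebra K C) (X N) (X M)"
  shows "contravariant_functor (comodule_cat K C) (rmodule_cat (dual_algebra K C))
    \<lparr>fobj = X, fmap = (\<lambda>M N f. \<lambda>g\<in>carrier (X N). compose (carrier M) g f)\<rparr>"
    (is "contravariant_functor ?C ?D ?F")
proof (intro contravariant_functor.intro contravariant_functor_axioms.intro)
  show "category ?C" "category ?D" by (rule category_comodule_cat category_rmodule_cat)+
  show "fobj ?F M \<in> Ob ?D" if "M \<in> Ob ?C" for M
    using that mod by (simp add: comodule_cat_def rmodule_cat_def)
  show "fmap ?F M N f \<in> Hom ?D (fobj ?F N) (fobj ?F M)" if "M \<in> Ob ?C" "N \<in> Ob ?C" "f \<in> Hom ?C M N" for M N f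
    using that hom by (simp add: comodule_cat_def rmodule_cat_def)
  show "fmap ?F M M (Ide ?C M) = Ide ?D (fobj ?F M)" if "M \<in> Ob ?C" for M
    using that
    by (auto simp: comodule_cat_def rmodule_cat_def fun_eq_iff compose_def extensional_arb[OF val])
  show "fmap ?F M P (Cmp ?C M N P g f) =
      Cmp ?D (fobj ?F P) (fobj ?F N) (fobj ?F M) (fmap ?F M N f) (fmap ?F N P g)"
    if "M \<in> Ob ?C" "N \<in> Ob ?C" "P \<in> Ob ?C" "f \<in> Hom ?C M N" "g \<in> Hom ?C N P" for M N P f g
    using that comp[of N P g] comodule_maps_extensional[of f K C M N]
    by (auto simp: comodule_cat_def rmodule_cat_def fun_eq_iff compose_def PiE_def Pi_def)
qed

lemma F_contravariant_functor:
  "contravariant_functor (comodule_cat K C :: (('k, 'm, 'c) comodule, 'm \<Rightarrow> 'm) cat)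
    (rmodule_cat (dual_algebra K C)) (F_functor K C)"
  unfolding F_functor_def
proof (rule precomposition_functor)
  fix M N :: "('k, 'm, 'c) comodule" and f g
  assume M: "comodule K C M"
  interpret M: comodule K C M by (rule M)
  show "right_module (dual_algebra K C) (F_obj K C M)" by (rule M.F_right_module)
  show "g \<in> extensional (carrier M)" if "g \<in> carrier (F_obj K C M)"
    using that by (simp add: M.F_simps lin_maps_iff)
  assume N: "comodule K C N" and f: "f \<in> comodule_maps K C M N"
  interpret N: comodule K C N by (rule N)
  show "compose (carrier M) g f \<in> carrier (F_obj K C M)" if "g \<in> carrier (F_obj K C N)"
    by (rule functional_compose[OF M N f that])
  show "(\<lambda>g\<in>carrier (F_obj K C N). compose (carrier M) g f)
      \<in> rmodule_maps (dual_algebra K C) (F_obj K C N) (F_obj K C M)"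
    using functional_compose[OF M N f] N.functional_add_closed N.functional_act_closed
    by (auto simp: rmodule_maps_def M.F_simps N.F_simps compose_def comodule_map_act[OF M N f]
        comodule_map_closed[OF M N f] M.act_closed)
qed

lemma G_contravariant_functor:
  "contravariant_functor (comodule_cat K C :: (('k, 'm, 'c) comodule, 'm \<Rightarrow> 'm) cat)
    (rmodule_cat (dual_algebra K C)) (G_functor K C)"
  unfolding G_functor_def
proof (rule precomposition_functor)
  fix M N :: "('k, 'm, 'c) comodule" and f g
  assume M: "comodule K C M"
  interpret M: comodule K C M by (rule M)
  show "right_module (dual_algebra K C) (G_obj K C M)" by (rule M.G_right_module)
  show "g \<in> extensional (carrier M)" if "g \<in> carrier (G_obj K C M)"
    using that by (simp add: M.G_carrier_iff)
  assume N: "comodule K C N" and f: "f \<in> comodule_maps K C M N"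
  interpret N: comodule K C N by (rule N)
  interpret GN: right_module "dual_algebra K C" "G_obj K C N" by (rule N.G_right_module)
  interpret GN: abelian_group "G_obj K C N" by (rule GN.abelian_group)
  show "compose (carrier M) g f \<in> carrier (G_obj K C M)" if "g \<in> carrier (G_obj K C N)"
    by (rule equivariant_compose[OF M N f that])
  show "(\<lambda>g\<in>carrier (G_obj K C N). compose (carrier M) g f)
      \<in> rmodule_maps (dual_algebra K C) (G_obj K C N) (G_obj K C M)"
    using equivariant_compose[OF M N f] GN.ract_closed GN.a_closed
    by (auto simp: rmodule_maps_def M.G_simps N.G_simps compose_def comodule_map_closed[OF M N f])
qed

theorem theorem6p1:
  fixes K :: "('k, 'z) ring_scheme" and C :: "('k, 'c) coalgebra"
  assumes "field K" and "coalgebra K C"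
  shows
    "contravariant_functor
       (comodule_cat K C :: (('k, 'm, 'c) comodule, 'm \<Rightarrow> 'm) cat)
       (rmodule_cat (dual_algebra K C)) (F_functor K C) \<and>
     contravariant_functor
       (comodule_cat K C :: (('k, 'm, 'c) comodule, 'm \<Rightarrow> 'm) cat)
       (rmodule_cat (dual_algebra K C)) (G_functor K C) \<and>
     naturally_isomorphic
       (comodule_cat K C :: (('k, 'm, 'c) comodule, 'm \<Rightarrow> 'm) cat)
       (dual_algebra K C) (F_functor K C) (G_functor K C)"
proof (intro conjI)
  show "naturally_isomorphic (comodule_cat K C :: (('k, 'm, 'c) comodule, 'm \<Rightarrow> 'm) cat)
      (dual_algebra K C) (F_functor K C) (G_functor K C)"
    unfolding naturally_isomorphic_def
  proof (intro exI[of _ "comodule.coefficient_map K C"] conjI ballI)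
    fix M N :: "('k, 'm, 'c) comodule" and f :: "'m \<Rightarrow> 'm"
    assume "M \<in> Ob (comodule_cat K C)"
    then have M: "comodule K C M" by (simp add: comodule_cat_def)
    interpret M: comodule K C M by (rule M)
    show "M.coefficient_map \<in> rmodule_iso (dual_algebra K C) (fobj (F_functor K C) M) (fobj (G_functor K C) M)"
      using M.coefficient_map_iso by (simp add: F_functor_def G_functor_def)
    assume "N \<in> Ob (comodule_cat K C)"
    then have N: "comodule K C N" by (simp add: comodule_cat_def)
    interpret N: comodule K C N by (rule N)
    assume "f \<in> Hom (comodule_cat K C) M N"
    then have f: "f \<in> comodule_maps K C M N" by (simp add: comodule_cat_def)
    have "M.coefficient_map (compose (carrier M) g f) = compose (carrier M) (N.coefficient_map g) f"
      if g: "g \<in> lin_maps K N (base_module K)" for g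
    proof -
      have "compose (carrier M) g f \<in> lin_maps K M (base_module K)"
        using functional_compose[OF M N f, of g] g by (simp add: M.F_simps N.F_simps)
      then show ?thesis
        using g coefficient_compose[OF M N f g] comodule_map_closed[OF M N f]
        by (auto simp: M.coefficient_map_def N.coefficient_map_def fun_eq_iff) (auto simp: compose_def)
    qed
    then show "compose (carrier (fobj (F_functor K C) N)) M.coefficient_map (fmap (F_functor K C) M N f) =
        compose (carrier (fobj (F_functor K C) N)) (fmap (G_functor K C) M N f) N.coefficient_map"
      using N.coefficient_map_closed
      by (auto simp: F_functor_def G_functor_def N.F_simps fun_eq_iff) (auto simp: compose_def N.F_simps)
  qed
qed (rule F_contravariant_functor G_contravariant_functor)+

end
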